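(* Let $\mathcal{F}$ be an EB-extremal one-qubit channel and let $\mathcal{I}$ be the identity channel on a qubit. Then the two-qubit channels $\mathcal{F}\otimes\mathcal{I}$ and $\mathcal{I}\otimes\mathcal{F}$ are EA-extremal.
   Context: A qubit channel is a completely positive trace-preserving linear map on $M_2(\mathbb{C})$; a two-qubit channel is a completely positive trace-preserving linear map on $M_2(\mathbb{C})\otimes M_2(\mathbb{C})$ (not necessarily of product form). A state is a positive semidefinite operator of trace one. A two-qubit channel is called entanglement-annihilating (EA) if it maps every state on $\mathbb{C}^2\otimes\mathbb{C}^2$ to a state that is separable with respect to the partition qubit 1 | qubit 2. The set $\mathsf{T}_{\rm EA}$ of all EA two-qubit channels (including non-local ones) is convex; a two-qubit channel is called EA-extremal if it is an extreme point of $\mathsf{T}_{\rm EA}$. A qubit channel $\mathcal{F}$ is called entanglement-breaking (EB) if for every finite-dimensional ancilla and every state $\rho$ of system plus ancilla, $(\mathcal{F}\otimes\mathcal{I}_{\rm anc})[\rho]$ is separable with respect to the partition system | ancilla, where $\mathcal{I}_{\rm anc}$ is the identity channel on the ancilla. The set of EB qubit channels is convex; a qubit channel is called EB-extremal if it is an extreme point of this set. *)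

theory Defs
  imports "Jordan_Normal_Form.Matrix"
begin

definition psd :: "nat \<Rightarrow> complex mat \<Rightarrow> bool" where
  (* The order on complex numbers is that of HOL-Library.Complex_Order, so 0 \<le> z says
     that z is real and nonnegative; over the complex numbers this forces A to be Hermitian. *)
  "psd d A \<longleftrightarrow> A \<in> carrier_mat d d \<and> (\<forall>v \<in> carrier_vec d. 0 \<le> (A *\<^sub>v v) \<bullet>c v)"

definition mtrace :: "complex mat \<Rightarrow> complex" where
  "mtrace A = (\<Sum>i<dim_row A. A $$ (i, i))"

definition state :: "nat \<Rightarrow> complex mat \<Rightarrow> bool" where
  "state d \<rho> \<longleftrightarrow> psd d \<rho> \<and> mtrace \<rho> = 1"

(* The basis vector e_i \<otimes> e_k of C^d \<otimes> C^e (i < d, k < e) has index i * e + k in C^(d*e). *)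
definition tensor_mat :: "complex mat \<Rightarrow> complex mat \<Rightarrow> complex mat" where
  "tensor_mat A B = mat (dim_row A * dim_row B) (dim_col A * dim_col B)
     (\<lambda>(r, s). A $$ (r div dim_row B, s div dim_col B) * B $$ (r mod dim_row B, s mod dim_col B))"

definition separable :: "nat \<Rightarrow> nat \<Rightarrow> complex mat \<Rightarrow> bool" where
  "separable d e \<rho> \<longleftrightarrow> (\<exists>(m :: nat) (p :: nat \<Rightarrow> real) \<sigma> \<tau>.
     (\<forall>k<m. 0 \<le> p k \<and> state d (\<sigma> k) \<and> state e (\<tau> k)) \<and> (\<Sum>k<m. p k) = 1 \<and>
     \<rho> = mat (d * e) (d * e)
           (\<lambda>(r, s). \<Sum>k<m. complex_of_real (p k) * tensor_mat (\<sigma> k) (\<tau> k) $$ (r, s)))"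

(* A map on d x d matrices is a function on the type of all matrices, of which only the
   restriction to carrier_mat d d is meaningful. *)
definition linear_map :: "nat \<Rightarrow> (complex mat \<Rightarrow> complex mat) \<Rightarrow> bool" where
  "linear_map d \<Phi> \<longleftrightarrow>
     (\<forall>X \<in> carrier_mat d d. \<Phi> X \<in> carrier_mat d d) \<and>
     (\<forall>X \<in> carrier_mat d d. \<forall>Y \<in> carrier_mat d d. \<Phi> (X + Y) = \<Phi> X + \<Phi> Y) \<and>
     (\<forall>c. \<forall>X \<in> carrier_mat d d. \<Phi> (c \<cdot>\<^sub>m X) = c \<cdot>\<^sub>m \<Phi> X)"

definition unit_matrix :: "nat \<Rightarrow> nat \<Rightarrow> nat \<Rightarrow> complex mat" where
  "unit_matrix d i j = mat d d (\<lambda>(r, s). if r = i \<and> s = j then 1 else 0)"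

(* F \<otimes> G for F on d x d and G on e x e matrices, by linear extension from the products
   E_ij \<otimes> E_kl of matrix units; the lemma tensor_map_tensor_mat below gives its
   characteristic property. *)
definition tensor_map :: "nat \<Rightarrow> nat \<Rightarrow> (complex mat \<Rightarrow> complex mat) \<Rightarrow>
    (complex mat \<Rightarrow> complex mat) \<Rightarrow> complex mat \<Rightarrow> complex mat" where
  "tensor_map d e F G X = mat (d * e) (d * e)
     (\<lambda>(r, s). \<Sum>i<d. \<Sum>j<d. \<Sum>k<e. \<Sum>l<e. X $$ (i * e + k, j * e + l) *
        tensor_mat (F (unit_matrix d i j)) (G (unit_matrix e k l)) $$ (r, s))"

definition completely_positive :: "nat \<Rightarrow> (complex mat \<Rightarrow> complex mat) \<Rightarrow> bool" where
  "completely_positive d \<Phi> \<longleftrightarrow>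
     (\<forall>n X. psd (d * n) X \<longrightarrow> psd (d * n) (tensor_map d n \<Phi> id X))"

definition channel :: "nat \<Rightarrow> (complex mat \<Rightarrow> complex mat) \<Rightarrow> bool" where
  "channel d \<Phi> \<longleftrightarrow> linear_map d \<Phi> \<and> completely_positive d \<Phi> \<and>
     (\<forall>X \<in> carrier_mat d d. mtrace (\<Phi> X) = mtrace X)"

definition entanglement_annihilating :: "(complex mat \<Rightarrow> complex mat) \<Rightarrow> bool" where
  "entanglement_annihilating \<Phi> \<longleftrightarrow>
     channel (2 * 2) \<Phi> \<and> (\<forall>\<rho>. state (2 * 2) \<rho> \<longrightarrow> separable 2 2 (\<Phi> \<rho>))"

definition entanglement_breaking :: "(complex mat \<Rightarrow> complex mat) \<Rightarrow> bool" where
  "entanglement_breaking F \<longleftrightarrow>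
     channel 2 F \<and> (\<forall>n \<rho>. state (2 * n) \<rho> \<longrightarrow> separable 2 n (tensor_map 2 n F id \<rho>))"

(* Extreme points of a set S of maps on d x d matrices. Maps are compared on carrier_mat d d
   only: their values elsewhere carry no information. *)
definition extremal :: "nat \<Rightarrow> (complex mat \<Rightarrow> complex mat) set \<Rightarrow>
    (complex mat \<Rightarrow> complex mat) \<Rightarrow> bool" where
  "extremal d S \<Phi> \<longleftrightarrow> \<Phi> \<in> S \<and>
     (\<forall>\<Phi>1 \<in> S. \<forall>\<Phi>2 \<in> S. \<forall>t :: real. 0 < t \<longrightarrow> t < 1 \<longrightarrow>
        (\<forall>X \<in> carrier_mat d d.
           \<Phi> X = complex_of_real t \<cdot>\<^sub>m \<Phi>1 X + complex_of_real (1 - t) \<cdot>\<^sub>m \<Phi>2 X) \<longrightarrow>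
        (\<forall>X \<in> carrier_mat d d. \<Phi>1 X = \<Phi>2 X))"

definition EB_extremal :: "(complex mat \<Rightarrow> complex mat) \<Rightarrow> bool" where
  "EB_extremal F \<longleftrightarrow> extremal 2 {F. entanglement_breaking F} F"

definition EA_extremal :: "(complex mat \<Rightarrow> complex mat) \<Rightarrow> bool" where
  "EA_extremal \<Phi> \<longleftrightarrow> extremal (2 * 2) {\<Phi>. entanglement_annihilating \<Phi>} \<Phi>"

lemma linear_map_index:
  assumes F: "linear_map d F" and A: "A \<in> carrier_mat d d" and r: "r < d" and s: "s < d"
  shows "F A $$ (r, s) = (\<Sum>i<d. \<Sum>j<d. A $$ (i, j) * F (unit_matrix d i j) $$ (r, s))"
proof -
  define B where "B P = mat d d (\<lambda>(i, j). if (i, j) \<in> P then A $$ (i, j) else 0)" for P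
  have Bc: "B P \<in> carrier_mat d d" for P by (simp add: B_def)
  have E: "unit_matrix d i j \<in> carrier_mat d d" for i j by (simp add: unit_matrix_def)
  have cF: "F X \<in> carrier_mat d d" if "X \<in> carrier_mat d d" for X
    using F that by (auto simp: linear_map_def)
  have step: "F (c \<cdot>\<^sub>m E' + X) $$ (r, s) = c * F E' $$ (r, s) + F X $$ (r, s)"
    if "E' \<in> carrier_mat d d" "X \<in> carrier_mat d d" for c E' X
  proof -
    have "F (c \<cdot>\<^sub>m E' + X) = c \<cdot>\<^sub>m F E' + F X"
      using F that by (simp add: linear_map_def)
    then show ?thesis using cF[OF that(1)] cF[OF that(2)] r s by auto
  qed
  have "F (B P) $$ (r, s) = (\<Sum>(i, j)\<in>P. A $$ (i, j) * F (unit_matrix d i j) $$ (r, s))"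
    if "finite P" "P \<subseteq> {..<d} \<times> {..<d}" for P
    using that
  proof (induction P rule: finite_induct)
    case empty
    have "B {} = 0 \<cdot>\<^sub>m B {}" by (rule eq_matI) (auto simp: B_def)
    then have "F (B {}) = 0 \<cdot>\<^sub>m F (B {})" using F Bc unfolding linear_map_def by metis
    then have "F (B {}) $$ (r, s) = (0 \<cdot>\<^sub>m F (B {})) $$ (r, s)" by simp
    also have "\<dots> = 0" using cF[OF Bc, of "{}"] r s by auto
    finally show ?case by simp
  next
    case (insert x P)
    obtain i j where x: "x = (i, j)" by force
    have "B (insert x P) = A $$ (i, j) \<cdot>\<^sub>m unit_matrix d i j + B P"
      using insert x by (intro eq_matI) (auto simp: B_def unit_matrix_def)
    then show ?case using insert step[OF E Bc] x by simp
  qed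
  from this[of "{..<d} \<times> {..<d}"]
  have "F (B ({..<d} \<times> {..<d})) $$ (r, s)
      = (\<Sum>i<d. \<Sum>j<d. A $$ (i, j) * F (unit_matrix d i j) $$ (r, s))"
    by (simp add: sum.cartesian_product)
  moreover have "B ({..<d} \<times> {..<d}) = A"
    using A by (intro eq_matI) (auto simp: B_def)
  ultimately show ?thesis by simp
qed

lemma tensor_map_tensor_mat:
  assumes F: "linear_map d F" and G: "linear_map e G"
    and A: "A \<in> carrier_mat d d" and B: "B \<in> carrier_mat e e"
  shows "tensor_map d e F G (tensor_mat A B) = tensor_mat (F A) (G B)"
proof -
  have FA: "F A \<in> carrier_mat d d" and GB: "G B \<in> carrier_mat e e"
    using F G A B by (auto simp: linear_map_def)
  have FE: "F (unit_matrix d i j) \<in> carrier_mat d d" for i j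
    using F by (auto simp: linear_map_def unit_matrix_def)
  have GE: "G (unit_matrix e i j) \<in> carrier_mat e e" for i j
    using G by (auto simp: linear_map_def unit_matrix_def)
  have lt: "i * e + k < d * e" if "i < d" "k < e" for i k
  proof -
    have "i * e + k < Suc i * e" using that by simp
    also have "\<dots> \<le> d * e" using that by (intro mult_le_mono1) simp
    finally show ?thesis .
  qed
  have T: "tensor_mat P Q $$ (r, s) = P $$ (r div e, s div e) * Q $$ (r mod e, s mod e)"
    if "P \<in> carrier_mat d d" "Q \<in> carrier_mat e e" "r < d * e" "s < d * e" for P Q r s
    using that by (auto simp: tensor_mat_def)
  show ?thesis
  proof (rule eq_matI)
    fix r s assume "r < dim_row (tensor_mat (F A) (G B))" "s < dim_col (tensor_mat (F A) (G B))"
    then have rs: "r < d * e" "s < d * e" using FA GB by (auto simp: tensor_mat_def)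
    then have e: "0 < e" by (cases e) auto
    have q: "r div e < d" "s div e < d" "r mod e < e" "s mod e < e"
      using rs e by (auto simp: less_mult_imp_div_less)
    have "tensor_map d e F G (tensor_mat A B) $$ (r, s) =
      (\<Sum>i<d. \<Sum>j<d. \<Sum>k<e. \<Sum>l<e. (A $$ (i, j) * F (unit_matrix d i j) $$ (r div e, s div e)) *
         (B $$ (k, l) * G (unit_matrix e k l) $$ (r mod e, s mod e)))"
      using rs unfolding tensor_map_def
      by (simp add: T[OF A B lt lt] T[OF FE GE rs] mult.assoc mult.left_commute)
    also have "\<dots> = F A $$ (r div e, s div e) * G B $$ (r mod e, s mod e)"
      unfolding linear_map_index[OF F A q(1,2)] linear_map_index[OF G B q(3,4)]
      by (simp only: sum_distrib_right) (simp only: sum_distrib_left)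
    also have "\<dots> = tensor_mat (F A) (G B) $$ (r, s)" using T[OF FA GB rs] by simp
    finally show "tensor_map d e F G (tensor_mat A B) $$ (r, s) = tensor_mat (F A) (G B) $$ (r, s)" .
  qed (use FA GB in \<open>auto simp: tensor_map_def tensor_mat_def\<close>)
qed

end

theory Submission
  imports Defs
begin

text \<open>Suppose \<open>F \<otimes> I = t \<Phi> + (1 - t) \<Psi>\<close> with \<open>\<Phi>\<close>, \<open>\<Psi>\<close> entanglement-annihilating. On a product of
  pure states \<open>g g\<^sup>* \<otimes> f f\<^sup>*\<close> the left side is annihilated by \<open>a \<otimes> w\<close> for every \<open>w\<close> orthogonal to
  \<open>f\<close>, hence so are the two positive summands. Since this holds for all \<open>f\<close>, linearity forces
  \<open>\<Phi> = F\<^sub>1 \<otimes> I\<close> and \<open>\<Psi> = F\<^sub>2 \<otimes> I\<close>. Applying \<open>\<Phi>\<close> to a maximally entangled state shows that the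
  Choi matrix of \<open>F\<^sub>1\<close> is separable, so \<open>F\<^sub>1\<close> is of measure-and-prepare form and therefore
  entanglement breaking, and likewise \<open>F\<^sub>2\<close>. Now \<open>F = t F\<^sub>1 + (1 - t) F\<^sub>2\<close>, and extremality of \<open>F\<close>
  gives \<open>F\<^sub>1 = F\<^sub>2\<close>. The channel \<open>I \<otimes> F\<close> is reduced to \<open>F \<otimes> I\<close> by conjugation with the exchange of
  the two qubits.\<close>

section \<open>Positive semidefinite matrices\<close>

text \<open>The summands are not assumed to be of product form, so both the shape
  \<open>F\<^sub>1 \<otimes> I\<close> and the entanglement breaking property of
  \<open>F\<^sub>1\<close> must be extracted from them. The shape is read off block by block: for
  fixed \<open>g\<close>, each block of \<open>\<Phi> (tensor_mat (dyad 2 g) (dyad 2 f))\<close>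
  depends linearly on \<open>dyad 2 f\<close>. Off-diagonal blocks are not positive, so the kernel
  condition is used from the left and from the right; together they make the block a multiple of
  \<open>dyad 2 f\<close>. A linear map doing this for every \<open>f\<close> is a scalar, and the
  scalars of the four blocks form the matrix \<open>F\<^sub>1 (dyad 2 g)\<close>. The second gap is
  one of dimension: entanglement annihilation speaks of two qubits, entanglement breaking of
  ancillas of every size. The Choi matrix closes it, because a separable decomposition of this
  single two-qubit operator determines \<open>F\<^sub>1\<close> on all matrix units, and the
  resulting form can be applied next to any ancilla.\<close>

definition qform :: "nat \<Rightarrow> complex mat \<Rightarrow> (nat \<Rightarrow> complex) \<Rightarrow> complex" where
  "qform d A f = (\<Sum>i<d. \<Sum>j<d. A $$ (i, j) * f j * cnj (f i))"

text \<open>The rank-one operator \<open>f f\<^sup>*\<close>, left unnormalised so that the entries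
  of \<open>f\<close> are free variables in the polynomial identities below.\<close>

definition dyad :: "nat \<Rightarrow> (nat \<Rightarrow> complex) \<Rightarrow> complex mat" where
  "dyad d f = mat d d (\<lambda>(i, j). f i * cnj (f j))"

text \<open>Test vectors become plain functions, of which only the values below \<open>d\<close>
  enter; they can then be sliced and reindexed without dimension bookkeeping.\<close>

lemma psd_iff_qform: "psd d A \<longleftrightarrow> A \<in> carrier_mat d d \<and> (\<forall>f. 0 \<le> qform d A f)"
proof -
  have eq: "(A *\<^sub>v v) \<bullet>c v = qform d A (\<lambda>i. v $ i)"
    if "A \<in> carrier_mat d d" "v \<in> carrier_vec d" for v
    using that by (auto simp: scalar_prod_def qform_def sum_distrib_right lessThan_atLeast0
        intro!: sum.cong)
  have "qform d A f = qform d A (\<lambda>i. vec d f $ i)" for f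
    by (simp add: qform_def)
  then show ?thesis
    unfolding psd_def using eq by (metis vec_carrier)
qed

lemma qform_dyad: "qform d (dyad d g) f = (\<Sum>j<d. cnj (g j) * f j) * cnj (\<Sum>j<d. cnj (g j) * f j)"
  by (simp add: qform_def dyad_def sum_product mult_ac) (rule sum.swap)

lemma mult_cnj_nonneg: "0 \<le> z * cnj (z :: complex)"
  by (simp add: less_eq_complex_def)

lemma psd_dyad: "psd d (dyad d f)"
  unfolding psd_iff_qform qform_dyad
  using mult_cnj_nonneg by (simp add: dyad_def del: cnj_sum)

lemma qform_basis:
  assumes "i < d"
  shows "qform d A (\<lambda>j. if j = i then 1 else 0) = A $$ (i, i)"
proof -
  have "(\<Sum>j<d. A $$ (k, j) * (if j = i then 1 else 0) * cnj (if k = i then 1 else 0))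
      = (\<Sum>j<d. if j = i then if k = i then A $$ (i, i) else 0 else 0)" for k
    by (intro sum.cong) auto
  then show ?thesis using assms by (simp add: qform_def)
qed

lemma psd_diag:
  assumes "psd d A" "i < d"
  shows "0 \<le> A $$ (i, i)"
  using assms qform_basis[of i d A] by (metis psd_iff_qform)

section \<open>Null vectors of positive forms\<close>

text \<open>For small \<open>c\<close> the linear terms dominate, and they change sign with
  \<open>c\<close>. Real and imaginary \<open>c\<close> of any size settle two real components; that
  the values at the fourth roots of unity are real settles the other two.\<close>

lemma hermitian_perturbation_zero:
  fixes R L q :: complex
  assumes "\<And>c. 0 \<le> cnj c * R + c * L + c * cnj c * q"
  shows "R = 0 \<and> L = 0"
proof -
  have small: "x = 0" if "\<And>e :: real. 0 \<le> e * x + e\<^sup>2 * y" for x y :: real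
  proof (rule ccontr)
    assume x: "x \<noteq> 0"
    \<comment> \<open>Any \<open>z\<close> above \<open>y\<close> and positive makes the quadratic
      term lose against the linear one at \<open>e = - x / z\<close>.\<close>
    define z where "z = \<bar>y\<bar> + 1"
    have z: "z > 0" "y < z" by (auto simp: z_def)
    define e where "e = - x / z"
    have "e * x + e\<^sup>2 * y = x\<^sup>2 / z\<^sup>2 * (y - z)"
      using z(1) by (simp add: e_def field_simps power2_eq_square)
    also have "\<dots> < 0" using x z by (intro mult_pos_neg) auto
    finally show False using that[of e] by simp
  qed
  have "Re (R + L) = 0"
    using assms[of "complex_of_real _"]
    by (intro small[of _ "Re q"]) (simp add: less_eq_complex_def power2_eq_square algebra_simps)
  moreover have "Im R - Im L = 0"
    using assms[of "\<i> * complex_of_real _"]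
    by (intro small[of _ "Re q"]) (simp add: less_eq_complex_def power2_eq_square algebra_simps)
  moreover have "Im R + Im L + Im q = 0" "- Im R - Im L + Im q = 0"
    using assms[of 1] assms[of "-1"] by (auto simp: less_eq_complex_def)
  moreover have "Re L - Re R + Im q = 0"  "Re R - Re L + Im q = 0"
    using assms[of \<i>] assms[of "-\<i>"] by (auto simp: less_eq_complex_def)
  ultimately show ?thesis by (simp add: complex_eq_iff)
qed

text \<open>Perturbing \<open>f\<close> by \<open>c\<close> times the basis vector
  \<open>e_i\<close> keeps the form nonnegative, and the terms of first order in \<open>c\<close>
  are exactly the two sums. A null vector of the form thus lies in the kernel from both
  sides.\<close>

lemma psd_null_vector:
  assumes A: "psd d A" and f: "qform d A f = 0" and i: "i < d"
  shows "(\<Sum>j<d. A $$ (i, j) * f j) = 0" "(\<Sum>j<d. cnj (f j) * A $$ (j, i)) = 0"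
proof -
  have "0 \<le> cnj c * (\<Sum>j<d. A $$ (i, j) * f j) + c * (\<Sum>j<d. cnj (f j) * A $$ (j, i))
      + c * cnj c * A $$ (i, i)" for c
  proof -
    let ?u = "\<lambda>j. if j = i then c else 0"
    have "0 \<le> qform d A (\<lambda>j. f j + ?u j)" using A by (simp add: psd_iff_qform)
    also have "qform d A (\<lambda>j. f j + ?u j) = qform d A f
        + (\<Sum>k<d. \<Sum>j<d. A $$ (k, j) * f j * cnj (?u k))
        + (\<Sum>k<d. \<Sum>j<d. A $$ (k, j) * ?u j * cnj (f k)) + (\<Sum>k<d. \<Sum>j<d. A $$ (k, j) * ?u j * cnj (?u k))"
      unfolding qform_def sum.distrib[symmetric]
      by (intro sum.cong refl) (simp only: complex_cnj_add distrib_left distrib_right add_ac)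
    also have "(\<Sum>k<d. \<Sum>j<d. A $$ (k, j) * f j * cnj (?u k)) = cnj c * (\<Sum>j<d. A $$ (i, j) * f j)"
      using i by (subst sum.swap) (simp add: if_distrib if_distribR sum_distrib_left mult_ac cong: if_cong)
    also have "(\<Sum>k<d. \<Sum>j<d. A $$ (k, j) * ?u j * cnj (f k)) = c * (\<Sum>j<d. cnj (f j) * A $$ (j, i))"
      using i by (simp add: if_distrib if_distribR sum_distrib_left mult_ac cong: if_cong)
    also have "(\<Sum>k<d. \<Sum>j<d. A $$ (k, j) * ?u j * cnj (?u k)) = c * cnj c * A $$ (i, i)"
    proof -
      have "(\<Sum>j<d. A $$ (k, j) * ?u j * cnj (?u k))
          = (\<Sum>j<d. if j = i then if k = i then c * cnj c * A $$ (i, i) else 0 else 0)" for k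
        by (intro sum.cong) auto
      then show ?thesis using i by simp
    qed
    finally show ?thesis using f by simp
  qed
  then show "(\<Sum>j<d. A $$ (i, j) * f j) = 0" "(\<Sum>j<d. cnj (f j) * A $$ (j, i)) = 0"
    using hermitian_perturbation_zero by blast+
qed

text \<open>Nonnegative diagonal entries with sum zero vanish, so every basis vector is a null
  vector and every column is zero.\<close>

lemma psd_zero_trace:
  assumes A: "psd d A" and tr: "mtrace A = 0" and ij: "i < d" "j < d"
  shows "A $$ (i, j) = 0"
proof -
  have "A \<in> carrier_mat d d" using A by (simp add: psd_iff_qform)
  then have "(\<Sum>k<d. A $$ (k, k)) = 0" using tr by (simp add: mtrace_def)
  then have "\<forall>k\<in>{..<d}. A $$ (k, k) = 0"
    by (subst (asm) sum_nonneg_eq_0_iff) (auto intro: psd_diag[OF A])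
  then have "A $$ (j, j) = 0" using ij by simp
  then have "qform d A (\<lambda>k. if k = j then 1 else 0) = 0"
    using ij qform_basis[of j d A] by simp
  from psd_null_vector(1)[OF A this ij(1)] show ?thesis
    using ij by (simp add: if_distrib if_distribR cong: if_cong)
qed

section \<open>Positive qubit operators as sums of two dyads\<close>

text \<open>Cholesky factorisation. If the corner \<open>a\<close> is nonzero, \<open>g\<close> is
  the first column divided by the root of \<open>a\<close>, and \<open>h\<close> carries the Schur
  complement on the second basis vector. If \<open>a = 0\<close>, the first basis vector is null, so
  \<open>b\<close> vanishes and only \<open>c\<close> is left.\<close>

lemma psd_2_dyads:
  assumes "psd 2 A"
  obtains g h where "\<And>i j. i < 2 \<Longrightarrow> j < 2 \<Longrightarrow> A $$ (i, j) = g i * cnj (g j) + h i * cnj (h j)"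
proof -
  define a b b' c where "a = A $$ (0,0)" and "b = A $$ (0,Suc 0)" and "b' = A $$ (Suc 0,0)"
    and "c = A $$ (Suc 0,Suc 0)"
  have a: "0 \<le> a" and c: "0 \<le> c" using psd_diag[OF assms, of 0] psd_diag[OF assms, of "Suc 0"] by (simp_all add: a_def c_def)
  have ar: "complex_of_real (Re a) = a" and cr: "complex_of_real (Re c) = c"
    using a c by (simp_all add: complex_eq_iff less_eq_complex_def)
  have Q: "0 \<le> a * f0 * cnj f0 + b * f1 * cnj f0 + b' * f0 * cnj f1 + c * f1 * cnj f1" for f0 f1
  proof -
    have "0 \<le> qform 2 A (\<lambda>i. if i = 0 then f0 else f1)" using assms by (simp add: psd_iff_qform)
    then show ?thesis
      by (simp add: qform_def numeral_2_eq_2 a_def b_def b'_def c_def add_ac)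
  qed
  have b': "b' = cnj b"
  proof -
    have "Im (b + b') = 0" "Re b - Re b' = 0"
      using Q[of 1 1] Q[of 1 \<i>] a c by (auto simp: less_eq_complex_def)
    then show ?thesis by (simp add: complex_eq_iff)
  qed
  have sq: "complex_of_real (sqrt x) * complex_of_real (sqrt x) = complex_of_real x" if "0 \<le> x" for x
    using that by (metis of_real_mult real_sqrt_mult_self abs_of_nonneg)
  show ?thesis
  proof (cases "a = 0")
    case True
    have "qform 2 A (\<lambda>k. if k = 0 then 1 else 0) = 0"
      using True by (simp add: qform_def numeral_2_eq_2 a_def)
    from psd_null_vector[OF assms this, of "Suc 0"] have "b' = 0" "b = 0"
      by (auto simp: numeral_2_eq_2 b_def b'_def)
    have Re_c: "0 \<le> Re c" using c by (simp add: less_eq_complex_def)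
    show ?thesis
    proof (rule that[of "\<lambda>_. 0" "\<lambda>i. if i = 0 then 0 else complex_of_real (sqrt (Re c))"])
      fix i j :: nat assume "i < 2" "j < 2"
      then consider "i = 0" "j = 0" | "i = 0" "j = Suc 0" | "i = Suc 0" "j = 0" | "i = Suc 0" "j = Suc 0"
        by linarith
      then show "A $$ (i, j) = 0 * cnj 0 + (if i = 0 then 0 else complex_of_real (sqrt (Re c)))
          * cnj (if j = 0 then 0 else complex_of_real (sqrt (Re c)))"
        using True \<open>b = 0\<close> \<open>b' = 0\<close> sq[OF Re_c] cr
        by cases (simp_all add: a_def b_def b'_def c_def)
    qed
  next
    case False
    then have pos: "0 < Re a" using a by (auto simp: less_eq_complex_def complex_eq_iff)
    define s where "s = complex_of_real (sqrt (Re a))"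
    have ss: "s * s = a" using sq[of "Re a"] pos ar by (simp add: s_def)
    have s0: "s \<noteq> 0" using pos by (simp add: s_def)
    have cs: "cnj s = s" by (simp add: s_def)
    define t where "t = Re c - (cmod b)\<^sup>2 / Re a"
    have t: "complex_of_real t = c - b * cnj b / a"
      by (simp add: t_def ar cr complex_norm_square del: of_real_power)
    \<comment> \<open>The vector \<open>(- b / a, 1)\<close> minimises the form among vectors with
      second coordinate 1; the minimum is the Schur complement.\<close>
    have "0 \<le> a * (- b / a) * cnj (- b / a) + b * 1 * cnj (- b / a) + b' * (- b / a) * cnj 1 + c * 1 * cnj 1"
      by (rule Q)
    also have "\<dots> = c - b * cnj b / a"
    proof -
      have "cnj a = a" by (subst (1 2) ar[symmetric]) simp
      then show ?thesis using False b' by (simp add: field_simps)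
    qed
    finally have t0: "0 \<le> t" unfolding t[symmetric] by (simp add: less_eq_complex_def)
    have A00: "A $$ (0, 0) = s * s" using ss a_def by simp
    have A01: "A $$ (0, Suc 0) = s * (b / s)" using s0 b_def by simp
    have A10: "A $$ (Suc 0, 0) = cnj b / s * s" using s0 b' b'_def by simp
    have "c = b * cnj b / (s * s) + complex_of_real t" unfolding t ss by simp
    then have A11: "A $$ (Suc 0, Suc 0) = cnj b / s * (b / s) + complex_of_real t"
      unfolding c_def[symmetric] by (simp add: mult.commute)
    show ?thesis
    proof (rule that[of "\<lambda>i. if i = 0 then s else cnj b / s" "\<lambda>i. if i = 0 then 0 else complex_of_real (sqrt t)"])
      fix i j :: nat assume "i < 2" "j < 2"
      then consider "i = 0" "j = 0" | "i = 0" "j = Suc 0" | "i = Suc 0" "j = 0" | "i = Suc 0" "j = Suc 0"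
        by linarith
      then show "A $$ (i, j) = (if i = 0 then s else cnj b / s) * cnj (if j = 0 then s else cnj b / s)
           + (if i = 0 then 0 else complex_of_real (sqrt t)) * cnj (if j = 0 then 0 else complex_of_real (sqrt t))"
        using A00 A01 A10 A11 cs sq[OF t0] by cases simp_all
    qed
  qed
qed

text \<open>Splitting \<open>A\<close> into dyads turns the pairing into two values of the form
  \<open>B\<close>, at the conjugates of \<open>g\<close> and \<open>h\<close>. Positivity of tensor
  products and of contractions is reduced to this pairing, which is why their first factor is a
  qubit.\<close>

lemma psd_2_pairing_nonneg:
  assumes A: "psd 2 A" and B: "\<And>f. 0 \<le> (\<Sum>i<2. \<Sum>j<2. B i j * f j * cnj (f i))"
  shows "0 \<le> (\<Sum>i<2. \<Sum>j<2. A $$ (i, j) * B i j)"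
proof -
  obtain g h where gh: "\<And>i j. i < 2 \<Longrightarrow> j < 2 \<Longrightarrow> A $$ (i, j) = g i * cnj (g j) + h i * cnj (h j)"
    using psd_2_dyads[OF A] by blast
  have "(\<Sum>i<2. \<Sum>j<2. A $$ (i, j) * B i j) =
    (\<Sum>i<2. \<Sum>j<2. B i j * cnj (g j) * cnj (cnj (g i))) + (\<Sum>i<2. \<Sum>j<2. B i j * cnj (h j) * cnj (cnj (h i)))"
    by (simp add: gh sum.distrib[symmetric] algebra_simps)
  then show ?thesis using B[of "\<lambda>i. cnj (g i)"] B[of "\<lambda>i. cnj (h i)"] by simp
qed

section \<open>Tensor products\<close>

lemma mult_add_less:
  fixes i k d e :: nat
  assumes "i < d" "k < e"
  shows "i * e + k < d * e"
proof -
  have "i * e + k < Suc i * e" using assms by simp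
  also have "\<dots> \<le> d * e" using assms by (intro mult_le_mono1) simp
  finally show ?thesis .
qed

lemma div_mod_less:
  fixes r d e :: nat
  assumes "r < d * e"
  shows "r div e < d" "r mod e < e"
  using assms by (auto simp: less_mult_imp_div_less) (cases e; simp)

lemma sum_lessThan_mult:
  fixes g :: "nat \<Rightarrow> complex"
  shows "(\<Sum>r<d * n. g r) = (\<Sum>i<d. \<Sum>c<n. g (i * n + c))"
proof -
  have "(\<Sum>r<d * n. g r) = (\<Sum>i<d. sum g {i * n..<i * n + n})"
    by (rule sum.nat_group[symmetric])
  also have "\<dots> = (\<Sum>i<d. \<Sum>c<n. g (i * n + c))"
  proof (rule sum.cong[OF refl])
    fix i
    show "sum g {i * n..<i * n + n} = (\<Sum>c<n. g (i * n + c))"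
      using sum.shift_bounds_nat_ivl[of g 0 "i * n" n] by (simp add: lessThan_atLeast0 add.commute)
  qed
  finally show ?thesis .
qed

lemma qform_mult:
  "qform (d * n) X f = (\<Sum>i<d. \<Sum>j<d. \<Sum>c<n. \<Sum>e<n.
     X $$ (i * n + c, j * n + e) * f (j * n + e) * cnj (f (i * n + c)))"
  unfolding qform_def sum_lessThan_mult by (rule sum.cong[OF refl], rule sum.swap)

lemma tensor_mat_carrier:
  assumes "A \<in> carrier_mat d d" "B \<in> carrier_mat e e"
  shows "tensor_mat A B \<in> carrier_mat (d * e) (d * e)"
  using assms by (auto simp: tensor_mat_def)

lemma tensor_mat_index:
  assumes "A \<in> carrier_mat d d" "B \<in> carrier_mat e e" "i < d" "j < d" "k < e" "l < e"
  shows "tensor_mat A B $$ (i * e + k, j * e + l) = A $$ (i, j) * B $$ (k, l)"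
  using assms mult_add_less[of i d k e] mult_add_less[of j d l e] by (auto simp: tensor_mat_def)

lemma mtrace_tensor_mat:
  assumes "A \<in> carrier_mat d d" "B \<in> carrier_mat e e"
  shows "mtrace (tensor_mat A B) = mtrace A * mtrace B"
proof -
  have "mtrace (tensor_mat A B) = (\<Sum>r<d * e. tensor_mat A B $$ (r, r))"
    using assms by (simp add: mtrace_def tensor_mat_def)
  also have "\<dots> = (\<Sum>i<d. \<Sum>k<e. A $$ (i, i) * B $$ (k, k))"
    unfolding sum_lessThan_mult by (intro sum.cong refl) (simp add: tensor_mat_index[OF assms])
  finally show ?thesis using assms by (simp add: mtrace_def sum_product)
qed

text \<open>For a fixed test vector \<open>v\<close> the form pairs \<open>A\<close> with a
  two-by-two matrix. The form of that matrix at \<open>f\<close> is the form of \<open>B\<close> at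
  the combination of the two halves of \<open>v\<close> with coefficients \<open>f\<close>, hence
  nonnegative.\<close>

lemma psd_tensor_mat:
  assumes A: "psd 2 A" and B: "psd n B"
  shows "psd (2 * n) (tensor_mat A B)"
  unfolding psd_iff_qform
proof safe
  have Ac: "A \<in> carrier_mat 2 2" and Bc: "B \<in> carrier_mat n n"
    using A B by (auto simp: psd_iff_qform)
  then show "tensor_mat A B \<in> carrier_mat (2 * n) (2 * n)" by (rule tensor_mat_carrier)
  fix v
  have "qform (2 * n) (tensor_mat A B) v = (\<Sum>a<2. \<Sum>b<2. A $$ (a, b) *
      (\<Sum>c<n. \<Sum>e<n. B $$ (c, e) * v (b * n + e) * cnj (v (a * n + c))))"
    unfolding qform_mult sum_distrib_left
    by (intro sum.cong refl) (simp add: tensor_mat_index[OF Ac Bc])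
  also have "0 \<le> \<dots>"
  proof (rule psd_2_pairing_nonneg[OF A])
    fix f
    have "(\<Sum>i<2. \<Sum>j<2. (\<Sum>c<n. \<Sum>e<n. B $$ (c, e) * v (j * n + e) * cnj (v (i * n + c)))
        * f j * cnj (f i)) = qform n B (\<lambda>c. \<Sum>a<2. f a * v (a * n + c))"
      by (simp add: qform_def numeral_2_eq_2 sum_distrib_left sum_distrib_right sum.distrib algebra_simps)
    then show "0 \<le> (\<Sum>i<2. \<Sum>j<2. (\<Sum>c<n. \<Sum>e<n. B $$ (c, e) * v (j * n + e) * cnj (v (i * n + c)))
        * f j * cnj (f i))" using B by (simp add: psd_iff_qform)
  qed
  finally show "0 \<le> qform (2 * n) (tensor_mat A B) v" .
qed

text \<open>The partial trace of \<open>(A\<^sup>T \<otimes> I) X\<close> over the first qubit.\<close>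

definition contract :: "nat \<Rightarrow> complex mat \<Rightarrow> complex mat \<Rightarrow> complex mat" where
  "contract n A X = mat n n (\<lambda>(c, e). \<Sum>i<2. \<Sum>j<2. A $$ (i, j) * X $$ (i * n + c, j * n + e))"

text \<open>The matrix paired with \<open>A\<close> is positive because its form at \<open>f\<close>
  is the form of \<open>X\<close> at the product vector of \<open>f\<close> and
  \<open>v\<close>.\<close>

lemma psd_contract:
  assumes A: "psd 2 A" and X: "psd (2 * n) X"
  shows "psd n (contract n A X)"
  unfolding psd_iff_qform
proof safe
  show "contract n A X \<in> carrier_mat n n" by (simp add: contract_def)
  fix v
  let ?B = "\<lambda>i j. \<Sum>c<n. \<Sum>e<n. X $$ (i * n + c, j * n + e) * v e * cnj (v c)"
  have "qform n (contract n A X) v = (\<Sum>i<2. \<Sum>j<2. A $$ (i, j) * ?B i j)"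
    by (simp add: qform_def contract_def numeral_2_eq_2 sum_distrib_left sum_distrib_right
        sum.distrib[symmetric] algebra_simps)
  also have "0 \<le> \<dots>"
  proof (rule psd_2_pairing_nonneg[OF A])
    fix f
    have "(\<Sum>i<2. \<Sum>j<2. ?B i j * f j * cnj (f i)) = qform (2 * n) X (\<lambda>r. f (r div n) * v (r mod n))"
      unfolding qform_mult sum_distrib_right by (intro sum.cong refl) simp
    then show "0 \<le> (\<Sum>i<2. \<Sum>j<2. ?B i j * f j * cnj (f i))" using X by (simp add: psd_iff_qform)
  qed
  finally show "0 \<le> qform n (contract n A X) v" .
qed

lemma psd_nonneg_combination:
  assumes "\<And>k. k < m \<Longrightarrow> 0 \<le> (c k :: real)" "\<And>k. k < m \<Longrightarrow> psd d (A k)"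
  shows "psd d (mat d d (\<lambda>(r, s). \<Sum>k<m. complex_of_real (c k) * A k $$ (r, s)))"
  unfolding psd_iff_qform
proof safe
  fix v
  have "qform d (mat d d (\<lambda>(r, s). \<Sum>k<m. complex_of_real (c k) * A k $$ (r, s))) v
      = (\<Sum>i<d. \<Sum>j<d. \<Sum>k<m. complex_of_real (c k) * (A k $$ (i, j) * v j * cnj (v i)))"
    by (simp add: qform_def sum_distrib_right mult.assoc)
  also have "\<dots> = (\<Sum>i<d. \<Sum>k<m. \<Sum>j<d. complex_of_real (c k) * (A k $$ (i, j) * v j * cnj (v i)))"
    by (intro sum.cong refl, rule sum.swap)
  also have "\<dots> = (\<Sum>k<m. complex_of_real (c k) * qform d (A k) v)"
    by (subst sum.swap) (simp add: qform_def sum_distrib_left)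
  also have "0 \<le> \<dots>"
  proof (rule sum_nonneg)
    fix k assume "k \<in> {..<m}"
    then have "0 \<le> c k" "0 \<le> qform d (A k) v" using assms by (auto simp: psd_iff_qform)
    then show "0 \<le> complex_of_real (c k) * qform d (A k) v"
      by (simp add: less_eq_complex_def)
  qed
  finally show "0 \<le> qform d (mat d d (\<lambda>(r, s). \<Sum>k<m. complex_of_real (c k) * A k $$ (r, s))) v" .
qed simp

section \<open>The map \<open>F \<otimes> I\<close> in coordinates\<close>

lemma linear_map_carrier: "linear_map d F \<Longrightarrow> X \<in> carrier_mat d d \<Longrightarrow> F X \<in> carrier_mat d d"
  by (simp add: linear_map_def)

lemma unit_matrix_carrier: "unit_matrix d i j \<in> carrier_mat d d"
  by (simp add: unit_matrix_def)

text \<open>The identity collapses the sums over matrix units of the second factor: \<open>F\<close>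
  mixes first indices only. Later coordinate computations with \<open>F \<otimes> I\<close> go
  through this formula.\<close>

lemma tensor_map_id_index:
  assumes F: "linear_map d F" and "r < d * e" "s < d * e"
  shows "tensor_map d e F id X $$ (r, s) = (\<Sum>i<d. \<Sum>j<d.
    X $$ (i * e + r mod e, j * e + s mod e) * F (unit_matrix d i j) $$ (r div e, s div e))"
proof -
  note q = div_mod_less[OF assms(2)] div_mod_less[OF assms(3)]
  have "tensor_mat (F (unit_matrix d i j)) (unit_matrix e k l) $$ (r, s) =
     (if k = r mod e then if l = s mod e then F (unit_matrix d i j) $$ (r div e, s div e) else 0 else 0)" for i j k l
    using tensor_mat_index[OF linear_map_carrier[OF F unit_matrix_carrier[of d i j]]
      unit_matrix_carrier[of e k l] q(1) q(3) q(2) q(4)] q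
    by (auto simp: unit_matrix_def)
  then have "tensor_map d e F id X $$ (r, s) = (\<Sum>i<d. \<Sum>j<d. \<Sum>k<e. \<Sum>l<e.
      if k = r mod e then if l = s mod e then X $$ (i * e + k, j * e + l) * F (unit_matrix d i j) $$ (r div e, s div e) else 0 else 0)"
    using assms by (auto simp: tensor_map_def intro!: sum.cong)
  also have "\<dots> = (\<Sum>i<d. \<Sum>j<d. X $$ (i * e + r mod e, j * e + s mod e)
      * F (unit_matrix d i j) $$ (r div e, s div e))"
  proof (intro sum.cong refl)
    fix i j
    let ?t = "\<lambda>k l. X $$ (i * e + k, j * e + l) * F (unit_matrix d i j) $$ (r div e, s div e)"
    have "(\<Sum>l<e. if k = r mod e then if l = s mod e then ?t k l else 0 else 0)
       = (if k = r mod e then ?t k (s mod e) else 0)" for k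
      using q by simp
    then show "(\<Sum>k<e. \<Sum>l<e. if k = r mod e then if l = s mod e then ?t k l else 0 else 0) = ?t (r mod e) (s mod e)"
      using q by simp
  qed
  finally show ?thesis .
qed

lemma tensor_map_carrier: "tensor_map d e F G X \<in> carrier_mat (d * e) (d * e)"
  by (simp add: tensor_map_def)

lemma mtrace_unit_matrix:
  assumes "i < d" "j < d"
  shows "mtrace (unit_matrix d i j) = (if i = j then 1 else 0)"
proof -
  have "mtrace (unit_matrix d i j) = (\<Sum>k<d. if k = i then if i = j then 1 else 0 else 0)"
    unfolding mtrace_def by (intro sum.cong) (auto simp: unit_matrix_def)
  then show ?thesis using assms by simp
qed

lemma mtrace_tensor_map_id:
  assumes F: "linear_map d F" and tr: "\<forall>X\<in>carrier_mat d d. mtrace (F X) = mtrace X"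
    and X: "X \<in> carrier_mat (d * e) (d * e)"
  shows "mtrace (tensor_map d e F id X) = mtrace X"
proof -
  have dim: "F (unit_matrix d i j) \<in> carrier_mat d d" for i j
    by (rule linear_map_carrier[OF F unit_matrix_carrier])
  have "mtrace (tensor_map d e F id X) = (\<Sum>a<d. \<Sum>c<e. tensor_map d e F id X $$ (a * e + c, a * e + c))"
    using tensor_map_carrier[of d e F id X] by (simp add: mtrace_def sum_lessThan_mult)
  also have "\<dots> = (\<Sum>a<d. \<Sum>c<e. \<Sum>i<d. \<Sum>j<d.
      X $$ (i * e + c, j * e + c) * F (unit_matrix d i j) $$ (a, a))"
    by (intro sum.cong refl) (simp add: tensor_map_id_index[OF F] mult_add_less)
  also have "\<dots> = (\<Sum>c<e. \<Sum>i<d. \<Sum>j<d. X $$ (i * e + c, j * e + c) * mtrace (F (unit_matrix d i j)))"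
  proof -
    have "(\<Sum>c<e. \<Sum>i<d. \<Sum>j<d. X $$ (i * e + c, j * e + c) * mtrace (F (unit_matrix d i j)))
      = (\<Sum>c<e. \<Sum>i<d. \<Sum>j<d. \<Sum>a<d. X $$ (i * e + c, j * e + c) * F (unit_matrix d i j) $$ (a, a))"
      using dim by (auto simp: mtrace_def sum_distrib_left intro!: sum.cong)
    also have "\<dots> = (\<Sum>c<e. \<Sum>i<d. \<Sum>a<d. \<Sum>j<d. X $$ (i * e + c, j * e + c) * F (unit_matrix d i j) $$ (a, a))"
      by (rule sum.cong[OF refl], rule sum.cong[OF refl], rule sum.swap)
    also have "\<dots> = (\<Sum>c<e. \<Sum>a<d. \<Sum>i<d. \<Sum>j<d. X $$ (i * e + c, j * e + c) * F (unit_matrix d i j) $$ (a, a))"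
      by (rule sum.cong[OF refl], rule sum.swap)
    finally show ?thesis by (subst sum.swap) simp
  qed
  also have "\<dots> = (\<Sum>c<e. \<Sum>i<d. \<Sum>j<d. if j = i then X $$ (i * e + c, i * e + c) else 0)"
    using tr by (intro sum.cong refl) (auto simp: mtrace_unit_matrix unit_matrix_carrier)
  also have "\<dots> = (\<Sum>i<d. \<Sum>c<e. X $$ (i * e + c, i * e + c))"
    by (subst sum.swap) simp
  also have "\<dots> = mtrace X" using X by (simp add: mtrace_def sum_lessThan_mult)
  finally show ?thesis .
qed

section \<open>Entanglement breaking channels\<close>

lemma state_unit_matrix:
  assumes "i < d"
  shows "state d (unit_matrix d i i)"
proof -
  have eq: "unit_matrix d i i = dyad d (\<lambda>j. if j = i then 1 else 0)"
    by (rule eq_matI) (auto simp: unit_matrix_def dyad_def)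
  show ?thesis
    using assms psd_dyad[of d "\<lambda>j. if j = i then 1 else 0", folded eq] by (simp add: state_def mtrace_unit_matrix)
qed

lemma mtrace_nonneg:
  assumes "psd d A"
  shows "0 \<le> mtrace A"
proof -
  have "mtrace A = (\<Sum>i<d. A $$ (i, i))" using assms by (auto simp: psd_iff_qform mtrace_def)
  then show ?thesis using psd_diag[OF assms] by (auto intro: sum_nonneg)
qed

lemma mtrace_combination:
  assumes "\<And>k. k < m \<Longrightarrow> A k \<in> carrier_mat d d"
  shows "mtrace (mat d d (\<lambda>(r, s). \<Sum>k<m. c k * A k $$ (r, s))) = (\<Sum>k<m. c k * mtrace (A k))"
proof -
  have "mtrace (mat d d (\<lambda>(r, s). \<Sum>k<m. c k * A k $$ (r, s))) = (\<Sum>i<d. \<Sum>k<m. c k * A k $$ (i, i))"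
    by (simp add: mtrace_def)
  also have "\<dots> = (\<Sum>k<m. \<Sum>i<d. c k * A k $$ (i, i))" by (rule sum.swap)
  also have "\<dots> = (\<Sum>k<m. c k * mtrace (A k))"
    using assms by (auto simp: mtrace_def sum_distrib_left intro!: sum.cong)
  finally show ?thesis .
qed

lemma state_normalize:
  assumes A: "psd d A" and tr: "mtrace A \<noteq> 0"
  shows "state d ((1 / mtrace A) \<cdot>\<^sub>m A)"
proof -
  have c: "A \<in> carrier_mat d d" using A by (simp add: psd_iff_qform)
  have "qform d ((1 / mtrace A) \<cdot>\<^sub>m A) f = (1 / mtrace A) * qform d A f" for f
    using c by (simp add: qform_def sum_distrib_left)
  moreover have inv: "0 \<le> 1 / mtrace A"
  proof -
    have m: "0 \<le> Re (mtrace A)" "complex_of_real (Re (mtrace A)) = mtrace A"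
      using mtrace_nonneg[OF A] by (simp_all add: less_eq_complex_def complex_eq_iff)
    then have "1 / mtrace A = complex_of_real (1 / Re (mtrace A))" by simp
    also have "0 \<le> \<dots>" using m(1) by (simp only: less_eq_complex_def) simp
    finally show ?thesis .
  qed
  ultimately have "psd d ((1 / mtrace A) \<cdot>\<^sub>m A)"
    using A mult_nonneg_nonneg[OF inv] by (simp add: psd_iff_qform del: times_divide_eq_left)
  moreover have "mtrace ((1 / mtrace A) \<cdot>\<^sub>m A) = (1 / mtrace A) * mtrace A"
    unfolding mtrace_def sum_distrib_left using c by (intro sum.cong) auto
  ultimately show ?thesis using tr by (simp add: state_def)
qed

text \<open>By linearity \<open>F X\<close> is the sum of the \<open>\<sigma> k\<close> with
  coefficients \<open>q k\<close> times the trace of the transpose of \<open>\<tau> k\<close> times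
  \<open>X\<close>: measure, then prepare. Hence \<open>F \<otimes> I\<close> sends \<open>X\<close>
  to the sum of \<open>q k\<close> times
  \<open>\<sigma> k \<otimes> contract n (\<tau> k) X\<close>, which shows complete positivity and
  separability for every ancilla dimension \<open>n\<close>; only the second factors remain to be
  normalised.\<close>

lemma measure_prepare_entanglement_breaking:
  fixes m :: nat
  assumes lin: "linear_map 2 F" and tr: "\<forall>X\<in>carrier_mat 2 2. mtrace (F X) = mtrace X"
    and q: "\<And>k. k < m \<Longrightarrow> 0 \<le> (q k :: real)"
    and \<sigma>: "\<And>k. k < m \<Longrightarrow> state 2 (\<sigma> k)" and \<tau>: "\<And>k. k < m \<Longrightarrow> psd 2 (\<tau> k)"
    and F: "\<And>i j a b. i < 2 \<Longrightarrow> j < 2 \<Longrightarrow> a < 2 \<Longrightarrow> b < 2 \<Longrightarrow>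
      F (unit_matrix 2 i j) $$ (a, b) = (\<Sum>k<m. complex_of_real (q k) * \<sigma> k $$ (a, b) * \<tau> k $$ (i, j))"
  shows "entanglement_breaking F"
proof -
  have \<sigma>c: "\<sigma> k \<in> carrier_mat 2 2" "psd 2 (\<sigma> k)" "mtrace (\<sigma> k) = 1" if "k < m" for k
    using \<sigma>[OF that] by (auto simp: state_def psd_iff_qform)
  have cc: "contract n A X \<in> carrier_mat n n" for n A X by (simp add: contract_def)
  have form: "tensor_map 2 n F id X = mat (2 * n) (2 * n)
      (\<lambda>(r, s). \<Sum>k<m. complex_of_real (q k) * tensor_mat (\<sigma> k) (contract n (\<tau> k) X) $$ (r, s))" for n X
  proof (rule eq_matI)
    fix r s assume "r < dim_row (mat (2 * n) (2 * n)
      (\<lambda>(r, s). \<Sum>k<m. complex_of_real (q k) * tensor_mat (\<sigma> k) (contract n (\<tau> k) X) $$ (r, s)))"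
      "s < dim_col (mat (2 * n) (2 * n)
      (\<lambda>(r, s). \<Sum>k<m. complex_of_real (q k) * tensor_mat (\<sigma> k) (contract n (\<tau> k) X) $$ (r, s)))"
    then have rs: "r < 2 * n" "s < 2 * n" by auto
    note d = div_mod_less[OF rs(1)] div_mod_less[OF rs(2)]
    have "tensor_map 2 n F id X $$ (r, s) = (\<Sum>i<2. \<Sum>j<2. X $$ (i * n + r mod n, j * n + s mod n)
        * (\<Sum>k<m. complex_of_real (q k) * \<sigma> k $$ (r div n, s div n) * \<tau> k $$ (i, j)))"
      unfolding tensor_map_id_index[OF lin rs] by (intro sum.cong refl) (simp add: F d)
    also have "\<dots> = (\<Sum>k<m. complex_of_real (q k) * \<sigma> k $$ (r div n, s div n)
        * contract n (\<tau> k) X $$ (r mod n, s mod n))"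
      using d by (simp add: contract_def numeral_2_eq_2 sum_distrib_left sum.distrib algebra_simps)
    also have "\<dots> = (\<Sum>k<m. complex_of_real (q k) * tensor_mat (\<sigma> k) (contract n (\<tau> k) X) $$ (r, s))"
      using tensor_mat_index[OF \<sigma>c(1) cc d(1) d(3) d(2) d(4)]
      by (intro sum.cong refl) (simp add: mult.assoc)
    finally show "tensor_map 2 n F id X $$ (r, s) = mat (2 * n) (2 * n) (\<lambda>(r, s). \<Sum>k<m.
        complex_of_real (q k) * tensor_mat (\<sigma> k) (contract n (\<tau> k) X) $$ (r, s)) $$ (r, s)"
      using rs by simp
  qed (auto simp: tensor_map_def)
  have "completely_positive 2 F"
    unfolding completely_positive_def form
    by (intro allI impI psd_nonneg_combination psd_tensor_mat psd_contract q \<sigma>c \<tau>)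
  then have ch: "channel 2 F" using lin tr by (simp add: channel_def)
  have "separable 2 n (tensor_map 2 n F id \<rho>)" if \<rho>: "state (2 * n) \<rho>" for n \<rho>
  proof -
    have psd: "psd (2 * n) \<rho>" "mtrace \<rho> = 1" and \<rho>c: "\<rho> \<in> carrier_mat (2 * n) (2 * n)"
      using \<rho> by (auto simp: state_def psd_iff_qform)
    \<comment> \<open>Needed for the default state in \<open>\<tau>'\<close>; a state in dimension
      zero would have trace zero.\<close>
    have n: "0 < n"
    proof (rule ccontr)
      assume "\<not> 0 < n"
      then have "mtrace \<rho> = 0" using \<rho>c by (simp add: mtrace_def)
      then show False using psd(2) by simp
    qed
    define \<omega> where "\<omega> k = contract n (\<tau> k) \<rho>" for k
    have \<omega>c: "\<omega> k \<in> carrier_mat n n" for k by (simp add: \<omega>_def cc)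
    have \<omega>: "psd n (\<omega> k)" if "k < m" for k
      unfolding \<omega>_def by (rule psd_contract[OF \<tau>[OF that] psd(1)])
    define p where "p k = q k * Re (mtrace (\<omega> k))" for k
    \<comment> \<open>A vanishing trace forces \<open>\<omega> k = 0\<close> and weight
      \<open>p k = 0\<close>, so any state may stand in.\<close>
    define \<tau>' where "\<tau>' k = (if mtrace (\<omega> k) = 0 then unit_matrix n 0 0 else (1 / mtrace (\<omega> k)) \<cdot>\<^sub>m \<omega> k)" for k
    have \<tau>': "state n (\<tau>' k)" if "k < m" for k
      using state_normalize[OF \<omega>[OF that]] state_unit_matrix[OF n] by (simp add: \<tau>'_def)
    then have \<tau>'c: "\<tau>' k \<in> carrier_mat n n" if "k < m" for k
      using that by (simp add: state_def psd_iff_qform)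
    have tr\<omega>: "complex_of_real (Re (mtrace (\<omega> k))) = mtrace (\<omega> k)" "0 \<le> Re (mtrace (\<omega> k))" if "k < m" for k
      using mtrace_nonneg[OF \<omega>[OF that]] by (simp_all add: less_eq_complex_def complex_eq_iff)
    have scale: "mtrace (\<omega> k) * \<tau>' k $$ (c, e) = \<omega> k $$ (c, e)" if "k < m" "c < n" "e < n" for k c e
    proof (cases "mtrace (\<omega> k) = 0")
      case True
      then show ?thesis using psd_zero_trace[OF \<omega> True] that by simp
    next
      case False
      then show ?thesis using that cc[of n "\<tau> k" \<rho>] by (simp add: \<tau>'_def \<omega>_def)
    qed
    \<comment> \<open>The weights add up to the trace of the output, which equals that of
      \<open>\<rho>\<close>.\<close>
    have "complex_of_real (\<Sum>k<m. p k) = (\<Sum>k<m. complex_of_real (q k) * mtrace (tensor_mat (\<sigma> k) (\<omega> k)))"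
      using tr\<omega> \<sigma>c(3) by (simp add: p_def mtrace_tensor_mat[OF \<sigma>c(1) \<omega>c])
    also have "\<dots> = mtrace (tensor_map 2 n F id \<rho>)"
      unfolding form \<omega>_def[symmetric]
      by (rule mtrace_combination[symmetric]) (rule tensor_mat_carrier[OF \<sigma>c(1) \<omega>c])
    also have "\<dots> = 1" using mtrace_tensor_map_id[OF lin tr \<rho>c] psd by simp
    finally have sum1: "(\<Sum>k<m. p k) = 1" using of_real_eq_1_iff by blast
    have eq: "tensor_map 2 n F id \<rho> = mat (2 * n) (2 * n)
           (\<lambda>(r, s). \<Sum>k<m. complex_of_real (p k) * tensor_mat (\<sigma> k) (\<tau>' k) $$ (r, s))"
      unfolding form
    proof (rule eq_matI, goal_cases)
      case (1 r s)
      then have rs: "r < 2 * n" "s < 2 * n" by auto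
      note d = div_mod_less[OF rs(1)] div_mod_less[OF rs(2)]
      have "complex_of_real (q k) * tensor_mat (\<sigma> k) (\<omega> k) $$ (r, s)
          = complex_of_real (p k) * tensor_mat (\<sigma> k) (\<tau>' k) $$ (r, s)" if k: "k < m" for k
        using tensor_mat_index[OF \<sigma>c(1)[OF k] \<omega>c[of k] d(1) d(3) d(2) d(4)]
          tensor_mat_index[OF \<sigma>c(1)[OF k] \<tau>'c[OF k] d(1) d(3) d(2) d(4)]
          scale[OF k d(2) d(4)] tr\<omega>[OF k]
        by (simp add: p_def mult_ac)
      then show ?case using rs by (simp add: \<omega>_def)
    qed auto
    have nn: "\<forall>k<m. 0 \<le> p k \<and> state 2 (\<sigma> k) \<and> state n (\<tau>' k)"
      using \<sigma> \<tau>' q tr\<omega> by (simp add: p_def)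
    show ?thesis
      unfolding separable_def
      by (rule exI[of _ m], rule exI[of _ p], rule exI[of _ \<sigma>], rule exI[of _ \<tau>'], intro conjI nn sum1 eq)
  qed
  with ch show ?thesis by (simp add: entanglement_breaking_def)
qed

section \<open>From entanglement breaking to entanglement annihilating\<close>

lemma linear_map_tensor_map: "linear_map (d * e) (tensor_map d e F G)"
  unfolding linear_map_def
proof (intro conjI ballI allI)
  fix X Y :: "complex mat" assume "X \<in> carrier_mat (d * e) (d * e)" "Y \<in> carrier_mat (d * e) (d * e)"
  then show "tensor_map d e F G (X + Y) = tensor_map d e F G X + tensor_map d e F G Y"
    by (intro eq_matI) (auto simp: tensor_map_def mult_add_less distrib_right sum.distrib)
next
  fix c and X :: "complex mat" assume "X \<in> carrier_mat (d * e) (d * e)"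
  then show "tensor_map d e F G (c \<cdot>\<^sub>m X) = c \<cdot>\<^sub>m tensor_map d e F G X"
    by (intro eq_matI) (auto simp: tensor_map_def mult_add_less sum_distrib_left mult.assoc)
qed (simp add: tensor_map_def)

lemma sum_swap_pairs:
  "(\<Sum>i\<in>A. \<Sum>j\<in>B. \<Sum>a\<in>C. \<Sum>b\<in>D. f i j a b) = (\<Sum>a\<in>C. \<Sum>b\<in>D. \<Sum>i\<in>A. \<Sum>j\<in>B. f i j a b)"
proof -
  have pull: "(\<Sum>j\<in>B. \<Sum>a\<in>C. \<Sum>b\<in>D. g j a b) = (\<Sum>a\<in>C. \<Sum>b\<in>D. \<Sum>j\<in>B. g j a b)" for B g
    by (subst sum.swap, rule sum.cong[OF refl], rule sum.swap)
  show ?thesis by (simp only: pull)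
qed

text \<open>Merging the two ancillas into one turns complete positivity of
  \<open>F \<otimes> I\<close> into that of \<open>F\<close>.\<close>

lemma tensor_map_id_assoc:
  assumes F: "linear_map d F"
  shows "tensor_map (d * e) n (tensor_map d e F id) id X = tensor_map d (e * n) F id X"
proof (rule eq_matI)
  fix r s assume "r < dim_row (tensor_map d (e * n) F id X)" "s < dim_col (tensor_map d (e * n) F id X)"
  then have rs: "r < d * (e * n)" "s < d * (e * n)" by (auto simp: tensor_map_def)
  then have rs': "r < d * e * n" "s < d * e * n" by (auto simp: mult.assoc)
  note p = div_mod_less[OF rs'(1)] div_mod_less[OF rs'(2)]
  note q = div_mod_less[OF p(1)] div_mod_less[OF p(3)]
  let ?f = "\<lambda>a b. F (unit_matrix d a b) $$ (r div n div e, s div n div e)"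
  have "tensor_map (d * e) n (tensor_map d e F id) id X $$ (r, s) =
    (\<Sum>i<d * e. \<Sum>j<d * e. X $$ (i * n + r mod n, j * n + s mod n) *
      (\<Sum>a<d. \<Sum>b<d. unit_matrix (d * e) i j $$ (a * e + r div n mod e, b * e + s div n mod e) * ?f a b))"
    unfolding tensor_map_id_index[OF linear_map_tensor_map rs'] tensor_map_id_index[OF F p(1) p(3)] ..
  also have "\<dots> = (\<Sum>i<d * e. \<Sum>j<d * e. \<Sum>a<d. \<Sum>b<d.
      if i = a * e + r div n mod e then if j = b * e + s div n mod e then
        X $$ (i * n + r mod n, j * n + s mod n) * ?f a b else 0 else 0)"
    unfolding sum_distrib_left using q
    by (intro sum.cong refl) (auto simp: unit_matrix_def mult_add_less)
  also have "\<dots> = (\<Sum>a<d. \<Sum>b<d. \<Sum>i<d * e. \<Sum>j<d * e.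
      if i = a * e + r div n mod e then if j = b * e + s div n mod e then
        X $$ (i * n + r mod n, j * n + s mod n) * ?f a b else 0 else 0)"
    by (rule sum_swap_pairs)
  also have "\<dots> = (\<Sum>a<d. \<Sum>b<d. X $$ ((a * e + r div n mod e) * n + r mod n,
      (b * e + s div n mod e) * n + s mod n) * ?f a b)"
  proof (intro sum.cong refl)
    fix a b assume ab: "a \<in> {..<d}" "b \<in> {..<d}"
    let ?t = "\<lambda>i j. X $$ (i * n + r mod n, j * n + s mod n) * ?f a b"
    have "(\<Sum>j<d * e. if i = a * e + r div n mod e then if j = b * e + s div n mod e then ?t i j else 0 else 0)
       = (if i = a * e + r div n mod e then ?t i (b * e + s div n mod e) else 0)" for i
      using ab q mult_add_less[of b d _ e] by simp
    then show "(\<Sum>i<d * e. \<Sum>j<d * e.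
      if i = a * e + r div n mod e then if j = b * e + s div n mod e then ?t i j else 0 else 0)
      = ?t (a * e + r div n mod e) (b * e + s div n mod e)"
      using ab q mult_add_less[of a d _ e] by simp
  qed
  also have "\<dots> = tensor_map d (e * n) F id X $$ (r, s)"
  proof -
    \<comment> \<open>The index of a triple product does not depend on the bracketing.\<close>
    have "x div (e * n) = x div n div e" "x mod (e * n) = n * (x div n mod e) + x mod n" for x
      by (metis div_mult2_eq mult.commute) (metis mod_mult2_eq mult.commute)
    then show ?thesis
      unfolding tensor_map_id_index[OF F rs] by (simp add: algebra_simps)
  qed
  finally show "tensor_map (d * e) n (tensor_map d e F id) id X $$ (r, s)
      = tensor_map d (e * n) F id X $$ (r, s)" .
qed (auto simp: tensor_map_def)

lemma entanglement_annihilating_tensor_map_id: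
  assumes "entanglement_breaking F"
  shows "entanglement_annihilating (tensor_map 2 2 F id)"
proof -
  have F: "linear_map 2 F" "completely_positive 2 F" "\<forall>X\<in>carrier_mat 2 2. mtrace (F X) = mtrace X"
    using assms by (auto simp: entanglement_breaking_def channel_def)
  have "completely_positive (2 * 2) (tensor_map 2 2 F id)"
    using F(2) unfolding completely_positive_def tensor_map_id_assoc[OF F(1)] by (simp only: mult.assoc) blast
  then have "channel (2 * 2) (tensor_map 2 2 F id)"
    using linear_map_tensor_map mtrace_tensor_map_id[OF F(1,3)] by (simp only: channel_def) blast
  then show ?thesis using assms by (simp add: entanglement_annihilating_def entanglement_breaking_def)
qed

section \<open>Convex decompositions of a channel tensored with the identity\<close>

text \<open>The left side is odd under \<open>s \<mapsto> - s\<close>, the right side even, so both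
  vanish. The values at 1 and \<open>\<i>\<close> then separate the two coefficients on each
  side.\<close>

lemma circle_coefficients_zero:
  fixes x y u v :: complex
  assumes "\<And>s. cnj s * x + s * y = cnj s * cnj s * u + s * cnj s * v"
  shows "x = 0 \<and> y = 0 \<and> u = 0 \<and> v = 0"
proof -
  have zero: "e = 0 \<and> z = 0" if "e = z" "- e = z" for e z :: complex
    using that by (auto simp: complex_eq_iff)
  have "x + y = u + v" using assms[of 1] by simp
  moreover have "- (x + y) = u + v" using assms[of "-1"] by simp
  ultimately have 1: "x + y = 0 \<and> u + v = 0" by (rule zero)
  have "\<i> * (y - x) = v - u" using assms[of \<i>] by (simp add: complex_eq_iff)
  moreover have "- (\<i> * (y - x)) = v - u" using assms[of "-\<i>"] by (simp add: complex_eq_iff)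
  ultimately have "\<i> * (y - x) = 0 \<and> v - u = 0" by (rule zero)
  then have 2: "y = x" "v = u" by simp_all
  have "x = 0 \<and> u = 0" using 1 unfolding 2 by simp
  then show ?thesis unfolding 2 by simp
qed

text \<open>Here \<open>T p q k l\<close> is the entry \<open>(k, l)\<close> of the image of the
  matrix unit \<open>E_pq\<close>, and \<open>M f\<close> the image of \<open>dyad 2 f\<close>. The
  conditions make each row of \<open>M f\<close> a multiple of the conjugate of \<open>f\<close> and
  each column a multiple of \<open>f\<close>; linearity rules out a factor that varies with
  \<open>f\<close>.\<close>

lemma kernel_preserving_scalar:
  fixes T :: "nat \<Rightarrow> nat \<Rightarrow> nat \<Rightarrow> nat \<Rightarrow> complex"
  defines "M \<equiv> \<lambda>f k l. \<Sum>p<2. \<Sum>q<2. f p * cnj (f q) * T p q k l"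
  assumes right: "\<And>f k. k < 2 \<Longrightarrow> M f k 0 * cnj (f 1) = M f k 1 * cnj (f 0)"
    and left: "\<And>f l. l < 2 \<Longrightarrow> f 1 * M f 0 l = f 0 * M f 1 l"
    and "p < 2" "q < 2" "k < 2" "l < 2"
  shows "T p q k l = (if p = k \<and> q = l then T 0 0 0 0 else 0)"
proof -
  define f :: "complex \<Rightarrow> complex \<Rightarrow> nat \<Rightarrow> complex" where "f a b i = (if i = 0 then a else b)" for a b i
  have M: "M (f a b) k l = a * cnj a * T 0 0 k l + a * cnj b * T 0 (Suc 0) k l + b * cnj a * T (Suc 0) 0 k l
     + b * cnj b * T (Suc 0) (Suc 0) k l" for a b k l
    by (simp add: M_def f_def numeral_2_eq_2 add_ac)
  have f: "f a b 0 = a" "f a b (Suc 0) = b" for a b by (simp_all add: f_def)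
  \<comment> \<open>By order of occurrence, instances of \<open>R\<close> take the first coordinate
    of \<open>f\<close> first, those of \<open>L\<close> the second.\<close>
  note R = right[of 0 "f _ _", simplified, unfolded f M] right[of "Suc 0" "f _ _", simplified, unfolded f M]
  note L = left[of 0 "f _ _", simplified, unfolded f M] left[of "Suc 0" "f _ _", simplified, unfolded f M]
  \<comment> \<open>The two basis vectors dispose of the entries with \<open>p = q\<close>, except
    those with \<open>p = q = k = l\<close>.\<close>
  have z00: "T 0 0 0 (Suc 0) = 0" "T 0 0 (Suc 0) (Suc 0) = 0" "T 0 0 (Suc 0) 0 = 0"
    using R(1)[of 1 0] R(2)[of 1 0] L(1)[of 0 1] by simp_all
  have z11: "T (Suc 0) (Suc 0) 0 0 = 0" "T (Suc 0) (Suc 0) (Suc 0) 0 = 0" "T (Suc 0) (Suc 0) 0 (Suc 0) = 0"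
    using R(1)[of 0 1] R(2)[of 0 1] L(2)[of 1 0] by simp_all
  \<comment> \<open>For \<open>f = (1, s)\<close> the right condition becomes a polynomial identity
    in \<open>s\<close> and its conjugate, of the shape treated above.\<close>
  have "T 0 (Suc 0) 0 (Suc 0) - T 0 0 0 0 = 0 \<and> T (Suc 0) 0 0 (Suc 0) = 0
     \<and> T 0 (Suc 0) 0 0 = 0 \<and> T (Suc 0) 0 0 0 = 0"
    using R(1)[of 1] by (intro circle_coefficients_zero) (simp add: z00 z11 algebra_simps)
  moreover have "T 0 (Suc 0) (Suc 0) (Suc 0) = 0 \<and> T (Suc 0) 0 (Suc 0) (Suc 0) = 0
     \<and> T 0 (Suc 0) (Suc 0) 0 = 0 \<and> T (Suc 0) 0 (Suc 0) 0 - T (Suc 0) (Suc 0) (Suc 0) (Suc 0) = 0"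
    using R(2)[of 1] by (intro circle_coefficients_zero) (simp add: z00 z11 algebra_simps)
  \<comment> \<open>So far there is one scalar for each row \<open>k\<close>; the left condition at
    \<open>(1, 1)\<close> equates them.\<close>
  moreover have "T (Suc 0) 0 (Suc 0) 0 = T 0 0 0 0"
    using L(1)[of 1 1] calculation z00 z11 by simp
  moreover have "p = 0 \<or> p = Suc 0" "q = 0 \<or> q = Suc 0" "k = 0 \<or> k = Suc 0" "l = 0 \<or> l = Suc 0"
    using assms(4-) by linarith+
  ultimately show ?thesis using z00 z11 by (elim disjE) simp_all
qed

lemma linear_map_dyad_index:
  assumes "linear_map d G" "r < d" "s < d"
  shows "G (dyad d f) $$ (r, s) = (\<Sum>i<d. \<Sum>j<d. f i * cnj (f j) * G (unit_matrix d i j) $$ (r, s))"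
proof -
  have "dyad d f \<in> carrier_mat d d" by (simp add: dyad_def)
  from linear_map_index[OF assms(1) this assms(2,3)] show ?thesis
    by (simp add: dyad_def)
qed

text \<open>Polarisation: the dyads of \<open>(1, 0)\<close>, \<open>(0, 1)\<close>,
  \<open>(1, 1)\<close> and \<open>(1, \<i>)\<close> span the qubit matrices.\<close>

lemma linear_map_eq_on_dyads:
  assumes G: "linear_map 2 G" and H: "linear_map 2 H"
    and eq: "\<And>f. G (dyad 2 f) = H (dyad 2 f)" and X: "X \<in> carrier_mat 2 2"
  shows "G X = H X"
proof (rule eq_matI)
  note c = linear_map_carrier[OF G X] linear_map_carrier[OF H X]
  then show "dim_row (G X) = dim_row (H X)" "dim_col (G X) = dim_col (H X)" by auto
  fix r s assume "r < dim_row (H X)" "s < dim_col (H X)"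
  then have rs: "r < 2" "s < 2" using c by auto
  define D where "D i j = G (unit_matrix 2 i j) $$ (r, s) - H (unit_matrix 2 i j) $$ (r, s)" for i j
  define f :: "complex \<Rightarrow> complex \<Rightarrow> nat \<Rightarrow> complex" where "f a b i = (if i = 0 then a else b)" for a b i
  have D: "a * cnj a * D 0 0 + a * cnj b * D 0 1 + b * cnj a * D 1 0 + b * cnj b * D 1 1 = 0" for a b
    using linear_map_dyad_index[OF G rs, of "f a b"] linear_map_dyad_index[OF H rs, of "f a b"] eq[of "f a b"]
    by (simp add: f_def D_def numeral_2_eq_2 algebra_simps)
  have "D 0 0 = 0" "D 1 1 = 0" using D[of 1 0] D[of 0 1] by simp_all
  moreover from this have "D 0 1 = 0" "D 1 0 = 0" using D[of 1 1] D[of 1 \<i>] by (simp_all add: complex_eq_iff)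
  ultimately have "D i j = 0" if "i < 2" "j < 2" for i j
    using that by (metis One_nat_def less_2_cases)
  then show "G X $$ (r, s) = H X $$ (r, s)"
    unfolding linear_map_index[OF G X rs] linear_map_index[OF H X rs]
    by (intro sum.cong refl) (simp add: D_def)
qed

section \<open>Bilinearity and partial evaluation of two-qubit maps\<close>

lemma tensor_mat_add_left:
  assumes "A \<in> carrier_mat d d" "B \<in> carrier_mat d d" "C \<in> carrier_mat e e"
  shows "tensor_mat (A + B) C = tensor_mat A C + tensor_mat B C"
proof (rule eq_matI)
  fix r s assume "r < dim_row (tensor_mat A C + tensor_mat B C)" "s < dim_col (tensor_mat A C + tensor_mat B C)"
  then have rs: "r < d * e" "s < d * e" using assms by (simp_all add: tensor_mat_def)
  note q = div_mod_less[OF rs(1)] div_mod_less[OF rs(2)]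
  show "(tensor_mat (A + B) C) $$ (r, s) = (tensor_mat A C + tensor_mat B C) $$ (r, s)"
    using assms rs q by (simp add: tensor_mat_def distrib_right)
qed (use assms in \<open>simp_all add: tensor_mat_def\<close>)

lemma tensor_mat_add_right:
  assumes "A \<in> carrier_mat d d" "B \<in> carrier_mat e e" "C \<in> carrier_mat e e"
  shows "tensor_mat A (B + C) = tensor_mat A B + tensor_mat A C"
proof (rule eq_matI)
  fix r s assume "r < dim_row (tensor_mat A B + tensor_mat A C)" "s < dim_col (tensor_mat A B + tensor_mat A C)"
  then have rs: "r < d * e" "s < d * e" using assms by (simp_all add: tensor_mat_def)
  note q = div_mod_less[OF rs(1)] div_mod_less[OF rs(2)]
  show "(tensor_mat A (B + C)) $$ (r, s) = (tensor_mat A B + tensor_mat A C) $$ (r, s)"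
    using assms rs q by (simp add: tensor_mat_def distrib_left)
qed (use assms in \<open>simp_all add: tensor_mat_def\<close>)

lemma tensor_mat_smult_left:
  assumes "A \<in> carrier_mat d d" "C \<in> carrier_mat e e"
  shows "tensor_mat (c \<cdot>\<^sub>m A) C = c \<cdot>\<^sub>m tensor_mat A C"
proof (rule eq_matI)
  fix r s assume "r < dim_row (c \<cdot>\<^sub>m tensor_mat A C)" "s < dim_col (c \<cdot>\<^sub>m tensor_mat A C)"
  then have rs: "r < d * e" "s < d * e" using assms by (simp_all add: tensor_mat_def)
  note q = div_mod_less[OF rs(1)] div_mod_less[OF rs(2)]
  show "(tensor_mat (c \<cdot>\<^sub>m A) C) $$ (r, s) = (c \<cdot>\<^sub>m tensor_mat A C) $$ (r, s)"
    using assms rs q by (simp add: tensor_mat_def)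
qed (use assms in \<open>simp_all add: tensor_mat_def\<close>)

lemma tensor_mat_smult_right:
  assumes "A \<in> carrier_mat d d" "C \<in> carrier_mat e e"
  shows "tensor_mat A (c \<cdot>\<^sub>m C) = c \<cdot>\<^sub>m tensor_mat A C"
proof (rule eq_matI)
  fix r s assume "r < dim_row (c \<cdot>\<^sub>m tensor_mat A C)" "s < dim_col (c \<cdot>\<^sub>m tensor_mat A C)"
  then have rs: "r < d * e" "s < d * e" using assms by (simp_all add: tensor_mat_def)
  note q = div_mod_less[OF rs(1)] div_mod_less[OF rs(2)]
  show "(tensor_mat A (c \<cdot>\<^sub>m C)) $$ (r, s) = (c \<cdot>\<^sub>m tensor_mat A C) $$ (r, s)"
    using assms rs q by (simp add: tensor_mat_def)
qed (use assms in \<open>simp_all add: tensor_mat_def\<close>)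

lemma linear_map_add:
  "linear_map d F \<Longrightarrow> X \<in> carrier_mat d d \<Longrightarrow> Y \<in> carrier_mat d d \<Longrightarrow> F (X + Y) = F X + F Y"
  by (simp add: linear_map_def)

lemma linear_map_smult:
  "linear_map d F \<Longrightarrow> X \<in> carrier_mat d d \<Longrightarrow> F (c \<cdot>\<^sub>m X) = c \<cdot>\<^sub>m F X"
  by (simp add: linear_map_def)

text \<open>One block of the output as a function of the second tensor factor. The varying argument
  comes last, so that partial application gives a linear map on qubit matrices.\<close>

definition block :: "(complex mat \<Rightarrow> complex mat) \<Rightarrow> nat \<Rightarrow> nat \<Rightarrow> complex mat \<Rightarrow> complex mat \<Rightarrow> complex mat" where
  "block \<Phi> a b X Y = mat 2 2 (\<lambda>(k, l). \<Phi> (tensor_mat X Y) $$ (a * 2 + k, b * 2 + l))"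

text \<open>The counterpart for the first tensor factor. At \<open>k = l = 0\<close> and
  \<open>Y = unit_matrix 2 0 0\<close> it is the candidate for the left factor of
  \<open>\<Phi>\<close>.\<close>

definition coblock :: "(complex mat \<Rightarrow> complex mat) \<Rightarrow> nat \<Rightarrow> nat \<Rightarrow> complex mat \<Rightarrow> complex mat \<Rightarrow> complex mat" where
  "coblock \<Phi> k l Y X = mat 2 2 (\<lambda>(a, b). \<Phi> (tensor_mat X Y) $$ (a * 2 + k, b * 2 + l))"

lemma linear_map_matI:
  fixes f :: "complex mat \<Rightarrow> nat \<Rightarrow> nat \<Rightarrow> complex"
  assumes "\<And>X Y r s. X \<in> carrier_mat d d \<Longrightarrow> Y \<in> carrier_mat d d \<Longrightarrow> r < d \<Longrightarrow> s < d \<Longrightarrow>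
      f (X + Y) r s = f X r s + f Y r s"
    and "\<And>c X r s. X \<in> carrier_mat d d \<Longrightarrow> r < d \<Longrightarrow> s < d \<Longrightarrow> f (c \<cdot>\<^sub>m X) r s = c * f X r s"
  shows "linear_map d (\<lambda>X. mat d d (\<lambda>(r, s). f X r s))"
  unfolding linear_map_def
proof (intro conjI ballI allI)
  fix X Y :: "complex mat" assume "X \<in> carrier_mat d d" "Y \<in> carrier_mat d d"
  then show "mat d d (\<lambda>(r, s). f (X + Y) r s) = mat d d (\<lambda>(r, s). f X r s) + mat d d (\<lambda>(r, s). f Y r s)"
    by (intro eq_matI) (simp_all add: assms(1))
next
  fix c and X :: "complex mat" assume "X \<in> carrier_mat d d"
  then show "mat d d (\<lambda>(r, s). f (c \<cdot>\<^sub>m X) r s) = c \<cdot>\<^sub>m mat d d (\<lambda>(r, s). f X r s)"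
    by (intro eq_matI) (simp_all add: assms(2))
qed simp

lemma add_index_carrier:
  fixes A B :: "complex mat"
  assumes "A \<in> carrier_mat d d" "B \<in> carrier_mat d d" "r < d" "s < d"
  shows "(A + B) $$ (r, s) = A $$ (r, s) + B $$ (r, s)"
  using assms by simp

lemma smult_index_carrier:
  fixes A :: "complex mat"
  assumes "A \<in> carrier_mat d d" "r < d" "s < d"
  shows "(c \<cdot>\<^sub>m A) $$ (r, s) = c * A $$ (r, s)"
  using assms by simp

lemma linear_map_block:
  assumes \<Phi>: "linear_map (2 * 2) \<Phi>" and X: "X \<in> carrier_mat 2 2" and "a < 2" "b < 2"
  shows "linear_map 2 (block \<Phi> a b X)"
  unfolding block_def
proof (rule linear_map_matI)
  note tc = tensor_mat_carrier[OF X]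
  note c = linear_map_carrier[OF \<Phi> tc]
  fix Y :: "complex mat" and r s :: nat assume Y: "Y \<in> carrier_mat 2 2" and "r < 2" "s < 2"
  then have lt: "a * 2 + r < 2 * 2" "b * 2 + s < 2 * 2"
    using assms(3,4) by (auto intro!: mult_add_less)
  show "\<Phi> (tensor_mat X (z \<cdot>\<^sub>m Y)) $$ (a * 2 + r, b * 2 + s) = z * \<Phi> (tensor_mat X Y) $$ (a * 2 + r, b * 2 + s)" for z
    unfolding tensor_mat_smult_right[OF X Y] linear_map_smult[OF \<Phi> tc[OF Y]] by (rule smult_index_carrier[OF c[OF Y] lt])
  fix Z :: "complex mat" assume Z: "Z \<in> carrier_mat 2 2"
  show "\<Phi> (tensor_mat X (Y + Z)) $$ (a * 2 + r, b * 2 + s) = \<Phi> (tensor_mat X Y) $$ (a * 2 + r, b * 2 + s) + \<Phi> (tensor_mat X Z) $$ (a * 2 + r, b * 2 + s)"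
    unfolding tensor_mat_add_right[OF X Y Z] linear_map_add[OF \<Phi> tc[OF Y] tc[OF Z]] by (rule add_index_carrier[OF c[OF Y] c[OF Z] lt])
qed

lemma linear_map_coblock:
  assumes \<Phi>: "linear_map (2 * 2) \<Phi>" and Y: "Y \<in> carrier_mat 2 2" and "k < 2" "l < 2"
  shows "linear_map 2 (coblock \<Phi> k l Y)"
  unfolding coblock_def
proof (rule linear_map_matI)
  note tc = tensor_mat_carrier[OF _ Y]
  note c = linear_map_carrier[OF \<Phi> tc]
  fix X :: "complex mat" and r s :: nat assume X: "X \<in> carrier_mat 2 2" and "r < 2" "s < 2"
  then have lt: "r * 2 + k < 2 * 2" "s * 2 + l < 2 * 2"
    using assms(3,4) by (auto intro!: mult_add_less)
  show "\<Phi> (tensor_mat (z \<cdot>\<^sub>m X) Y) $$ (r * 2 + k, s * 2 + l) = z * \<Phi> (tensor_mat X Y) $$ (r * 2 + k, s * 2 + l)" for z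
    unfolding tensor_mat_smult_left[OF X Y] linear_map_smult[OF \<Phi> tc[OF X]] by (rule smult_index_carrier[OF c[OF X] lt])
  fix Z :: "complex mat" assume Z: "Z \<in> carrier_mat 2 2"
  show "\<Phi> (tensor_mat (X + Z) Y) $$ (r * 2 + k, s * 2 + l) = \<Phi> (tensor_mat X Y) $$ (r * 2 + k, s * 2 + l) + \<Phi> (tensor_mat Z Y) $$ (r * 2 + k, s * 2 + l)"
    unfolding tensor_mat_add_left[OF X Z Y] linear_map_add[OF \<Phi> tc[OF X] tc[OF Z]] by (rule add_index_carrier[OF c[OF X] c[OF Z] lt])
qed

text \<open>Complete positivity with a one-dimensional ancilla.\<close>

lemma channel_positive:
  assumes "channel d \<Phi>" and X: "psd d X"
  shows "psd d (\<Phi> X)"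
proof -
  have lin: "linear_map d \<Phi>" and cp: "completely_positive d \<Phi>" using assms by (auto simp: channel_def)
  have Xc: "X \<in> carrier_mat d d" using X by (simp add: psd_iff_qform)
  have "tensor_map d 1 \<Phi> id X = \<Phi> X"
  proof (rule eq_matI)
    note c = linear_map_carrier[OF lin Xc]
    show "dim_row (tensor_map d 1 \<Phi> id X) = dim_row (\<Phi> X)" "dim_col (tensor_map d 1 \<Phi> id X) = dim_col (\<Phi> X)"
      using c by (auto simp: tensor_map_def)
    fix r s assume "r < dim_row (\<Phi> X)" "s < dim_col (\<Phi> X)"
    then have rs: "r < d" "s < d" using c by auto
    then show "tensor_map d 1 \<Phi> id X $$ (r, s) = \<Phi> X $$ (r, s)"
      using tensor_map_id_index[OF lin, of r 1 s X] linear_map_index[OF lin Xc rs] by simp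
  qed
  moreover have "psd (d * 1) (tensor_map d 1 \<Phi> id X)"
    using cp X unfolding completely_positive_def by (metis mult_1_right)
  ultimately show ?thesis by simp
qed

lemma psd_summand_null:
  assumes A: "psd d A" and B: "psd d B" and t: "0 < t" "t < 1"
    and C: "C = complex_of_real t \<cdot>\<^sub>m A + complex_of_real (1 - t) \<cdot>\<^sub>m B" and null: "qform d C v = 0"
  shows "qform d A v = 0"
proof -
  have "A \<in> carrier_mat d d" "B \<in> carrier_mat d d" using A B by (auto simp: psd_iff_qform)
  then have "qform d C v = complex_of_real t * qform d A v + complex_of_real (1 - t) * qform d B v"
    unfolding C by (simp add: qform_def sum_distrib_left sum.distrib distrib_right mult.assoc del: of_real_diff)
  moreover have "0 \<le> qform d A v" "0 \<le> qform d B v" using A B by (auto simp: psd_iff_qform)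
  ultimately have *: "t * Re (qform d A v) + (1 - t) * Re (qform d B v) = 0"
    "0 \<le> Re (qform d A v)" "0 \<le> Re (qform d B v)" "Im (qform d A v) = 0"
    using null by (simp_all add: less_eq_complex_def complex_eq_iff)
  then have "t * Re (qform d A v) \<le> 0"
    using t mult_nonneg_nonneg[of "1 - t" "Re (qform d B v)"] by linarith
  then show ?thesis using * t by (simp add: complex_eq_iff mult_le_0_iff)
qed

lemma sum_lessThan_2: "(\<Sum>k<2 :: nat. g k) = g 0 + (g 1 :: complex)"
  by (simp add: numeral_2_eq_2)

lemma linear_map_scale:
  assumes G: "linear_map d G"
  shows "linear_map d (\<lambda>X. c \<cdot>\<^sub>m G X)"
  unfolding linear_map_def
proof (intro conjI ballI allI)
  fix X Y :: "complex mat" assume X: "X \<in> carrier_mat d d" and Y: "Y \<in> carrier_mat d d"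
  show "c \<cdot>\<^sub>m G (X + Y) = c \<cdot>\<^sub>m G X + c \<cdot>\<^sub>m G Y"
    unfolding linear_map_add[OF G X Y]
    by (rule add_smult_distrib_left_mat[OF linear_map_carrier[OF G X] linear_map_carrier[OF G Y]])
next
  fix k and X :: "complex mat" assume X: "X \<in> carrier_mat d d"
  show "c \<cdot>\<^sub>m G (k \<cdot>\<^sub>m X) = k \<cdot>\<^sub>m (c \<cdot>\<^sub>m G X)"
    unfolding linear_map_smult[OF G X] by (rule eq_matI) auto
qed (simp add: linear_map_carrier[OF G])

text \<open>The identity on the second qubit forces both summands to map a product of pure states into
  the matrices supported on the same second factor.\<close>

lemma tensor_id_summand_product:
  assumes F: "linear_map 2 F" and \<Phi>: "channel (2 * 2) \<Phi>" and \<Psi>: "channel (2 * 2) \<Psi>" and t: "0 < t" "t < 1"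
    and sum: "\<And>X. X \<in> carrier_mat (2 * 2) (2 * 2) \<Longrightarrow>
      tensor_map 2 2 F id X = complex_of_real t \<cdot>\<^sub>m \<Phi> X + complex_of_real (1 - t) \<cdot>\<^sub>m \<Psi> X"
    and X: "X \<in> carrier_mat 2 2" and "p < 2" "q < 2" "k < 2" "l < 2" "a < 2" "b < 2"
  shows "\<Phi> (tensor_mat X (unit_matrix 2 p q)) $$ (a * 2 + k, b * 2 + l)
    = (if p = k \<and> q = l then \<Phi> (tensor_mat X (unit_matrix 2 0 0)) $$ (a * 2, b * 2) else 0)"
proof -
  have lin: "linear_map (2 * 2) \<Phi>" using \<Phi> by (simp add: channel_def)
  have dc: "dyad 2 f \<in> carrier_mat 2 2" for f by (simp add: dyad_def)
  have pure: "\<Phi> (tensor_mat (dyad 2 g) (unit_matrix 2 p q)) $$ (a * 2 + k, b * 2 + l)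
    = (if p = k \<and> q = l then \<Phi> (tensor_mat (dyad 2 g) (unit_matrix 2 0 0)) $$ (a * 2, b * 2) else 0)"
    if ab: "a < 2" "b < 2" and "k < 2" "l < 2" for g a b k l
  proof -
    define T where "T p q k l = block \<Phi> a b (dyad 2 g) (unit_matrix 2 p q) $$ (k, l)" for p q k l
    \<comment> \<open>This is the basis vector \<open>e_c\<close> tensored with
      \<open>(- cnj (f 1), cnj (f 0))\<close>, which is orthogonal to \<open>f\<close>.\<close>
    define w :: "(nat \<Rightarrow> complex) \<Rightarrow> nat \<Rightarrow> nat \<Rightarrow> complex" where
      "w f c r = (if r div 2 = c then if r mod 2 = 0 then - cnj (f 1) else cnj (f 0) else 0)" for f c r
    have w: "w f c (i * 2 + 0) = (if i = c then - cnj (f 1) else 0)"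
      "w f c (i * 2 + 1) = (if i = c then cnj (f 0) else 0)" for f c i by (simp_all add: w_def mod_Suc)
    let ?N = "\<lambda>f. \<Phi> (tensor_mat (dyad 2 g) (dyad 2 f))"
    have N: "(\<Sum>p<2. \<Sum>q<2. f p * cnj (f q) * T p q k l) = ?N f $$ (a * 2 + k, b * 2 + l)"
      if "k < 2" "l < 2" for f k l
      using linear_map_dyad_index[OF linear_map_block[OF lin dc ab] that, of g f] that
      by (simp add: T_def block_def)
    have pos: "psd (2 * 2) (tensor_mat (dyad 2 g) (dyad 2 f))" for f by (intro psd_tensor_mat psd_dyad)
    have null: "qform (2 * 2) (?N f) (w f c) = 0" if "c < 2" for f c
    proof (rule psd_summand_null[OF channel_positive[OF \<Phi> pos] channel_positive[OF \<Psi> pos] t sum])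
      show "tensor_mat (dyad 2 g) (dyad 2 f) \<in> carrier_mat (2 * 2) (2 * 2)" by (intro tensor_mat_carrier dc)
      have eq: "tensor_map 2 2 F id (tensor_mat (dyad 2 g) (dyad 2 f)) = tensor_mat (F (dyad 2 g)) (dyad 2 f)"
        using tensor_map_tensor_mat[OF F _ dc dc, where G = id] by (simp add: linear_map_def)
      note ix = tensor_mat_index[OF linear_map_carrier[OF F dc] dc]
      have "qform (2 * 2) (tensor_mat (F (dyad 2 g)) (dyad 2 f)) (w f c)
        = (\<Sum>i<2. \<Sum>j<2. \<Sum>k<2. \<Sum>l<2. F (dyad 2 g) $$ (i, j) * (f k * cnj (f l)) * w f c (j * 2 + l) * cnj (w f c (i * 2 + k)))"
        unfolding qform_mult by (intro sum.cong refl) (simp add: ix, simp add: dyad_def)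
      also have "\<dots> = 0"
      proof (rule sum.neutral, rule ballI, rule sum.neutral, rule ballI)
        fix i j
        show "(\<Sum>k<2. \<Sum>l<2. F (dyad 2 g) $$ (i, j) * (f k * cnj (f l)) * w f c (j * 2 + l) * cnj (w f c (i * 2 + k))) = 0"
          unfolding sum_lessThan_2 w by simp
      qed
      finally show "qform (2 * 2) (tensor_map 2 2 F id (tensor_mat (dyad 2 g) (dyad 2 f))) (w f c) = 0"
        unfolding eq .
    qed
    have "T p q k l = (if p = k \<and> q = l then T 0 0 0 0 else 0)"
    proof (rule kernel_preserving_scalar)
      fix f :: "nat \<Rightarrow> complex" and k :: nat assume k: "k < 2"
      \<comment> \<open>As \<open>w f b\<close> is supported in block \<open>b\<close>, this row of
        the kernel equation sees only row \<open>k\<close> of block \<open>(a, b)\<close>.\<close>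
      have "(\<Sum>s<2 * 2. ?N f $$ (a * 2 + k, s) * w f b s) = 0"
        by (rule psd_null_vector(1)[OF channel_positive[OF \<Phi> pos] null[OF ab(2)] mult_add_less[OF ab(1) k]])
      then show "(\<Sum>p<2. \<Sum>q<2. f p * cnj (f q) * T p q k 0) * cnj (f 1)
          = (\<Sum>p<2. \<Sum>q<2. f p * cnj (f q) * T p q k 1) * cnj (f 0)"
        using k N[of k 0 f] N[of k 1 f] less_2_cases[OF ab(2)]
        unfolding sum_lessThan_mult sum_lessThan_2 w by auto
    next
      fix f :: "nat \<Rightarrow> complex" and l :: nat assume l: "l < 2"
      have "(\<Sum>r<2 * 2. cnj (w f a r) * ?N f $$ (r, b * 2 + l)) = 0"
        by (rule psd_null_vector(2)[OF channel_positive[OF \<Phi> pos] null[OF ab(1)] mult_add_less[OF ab(2) l]])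
      then show "f 1 * (\<Sum>p<2. \<Sum>q<2. f p * cnj (f q) * T p q 0 l)
          = f 0 * (\<Sum>p<2. \<Sum>q<2. f p * cnj (f q) * T p q 1 l)"
        using l N[of 0 l f] N[of 1 l f] less_2_cases[OF ab(1)]
        unfolding sum_lessThan_mult sum_lessThan_2 w by auto
    qed fact+
    then show ?thesis using that by (simp add: T_def block_def)
  qed
  let ?c = "if p = k \<and> q = l then 1 else 0 :: complex"
  have uc: "unit_matrix 2 p q \<in> carrier_mat 2 2" for p q by (rule unit_matrix_carrier)
  have lin0: "linear_map 2 (coblock \<Phi> 0 0 (unit_matrix 2 0 0))"
    by (rule linear_map_coblock[OF lin uc]) simp_all
  \<comment> \<open>Both cases of the claim are one equation between linear maps of
    \<open>X\<close>, with factor \<open>?c\<close>, so it extends from dyads to all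
    \<open>X\<close>.\<close>
  have "coblock \<Phi> k l (unit_matrix 2 p q) X = ?c \<cdot>\<^sub>m coblock \<Phi> 0 0 (unit_matrix 2 0 0) X"
  proof (rule linear_map_eq_on_dyads[OF _ _ _ X])
    show "linear_map 2 (coblock \<Phi> k l (unit_matrix 2 p q))" by (rule linear_map_coblock[OF lin uc]) fact+
    show "linear_map 2 (\<lambda>X. ?c \<cdot>\<^sub>m coblock \<Phi> 0 0 (unit_matrix 2 0 0) X)"
      by (rule linear_map_scale[OF lin0])
    show "coblock \<Phi> k l (unit_matrix 2 p q) (dyad 2 g)
        = ?c \<cdot>\<^sub>m coblock \<Phi> 0 0 (unit_matrix 2 0 0) (dyad 2 g)" for g
      using pure \<open>k < 2\<close> \<open>l < 2\<close> by (intro eq_matI) (auto simp: coblock_def)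
  qed
  then have "coblock \<Phi> k l (unit_matrix 2 p q) X $$ (a, b)
      = (?c \<cdot>\<^sub>m coblock \<Phi> 0 0 (unit_matrix 2 0 0) X) $$ (a, b)" by simp
  then show ?thesis using \<open>a < 2\<close> \<open>b < 2\<close> by (auto simp: coblock_def)
qed

lemma tensor_mat_unit_matrix:
  assumes "i < d" "j < d" "k < e" "l < e"
  shows "tensor_mat (unit_matrix d i j) (unit_matrix e k l) = unit_matrix (d * e) (i * e + k) (j * e + l)"
proof (rule eq_matI)
  fix r s assume "r < dim_row (unit_matrix (d * e) (i * e + k) (j * e + l))"
    "s < dim_col (unit_matrix (d * e) (i * e + k) (j * e + l))"
  then have rs: "r < d * e" "s < d * e" by (auto simp: unit_matrix_def)
  note q = div_mod_less[OF rs(1)] div_mod_less[OF rs(2)]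
  have "x = y * e + z \<longleftrightarrow> x div e = y \<and> x mod e = z" if "z < e" for x y z
    using that by (auto simp: div_mult_mod_eq)
  then show "tensor_mat (unit_matrix d i j) (unit_matrix e k l) $$ (r, s)
      = unit_matrix (d * e) (i * e + k) (j * e + l) $$ (r, s)"
    using assms rs q by (simp add: unit_matrix_def tensor_mat_def)
qed (simp_all add: unit_matrix_def tensor_mat_def)

section \<open>Separable Choi matrices and the factorisation of the summands\<close>

text \<open>In a separable decomposition of the Choi matrix the first factors are the prepared
  states and the second factors, up to weights, the transposed effects of the measurement. Complete
  positivity of \<open>F\<close> arises from this form, trace preservation from
  \<open>\<Phi>\<close>.\<close>

lemma entanglement_breaking_left_factor:
  assumes \<Phi>: "entanglement_annihilating \<Phi>" and lin: "linear_map 2 F"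
    and eq: "\<And>X. X \<in> carrier_mat (2 * 2) (2 * 2) \<Longrightarrow> \<Phi> X = tensor_map 2 2 F id X"
  shows "entanglement_breaking F"
proof -
  have tr\<Phi>: "\<And>X. X \<in> carrier_mat (2 * 2) (2 * 2) \<Longrightarrow> mtrace (\<Phi> X) = mtrace X"
    using \<Phi> by (auto simp: entanglement_annihilating_def channel_def)
  have uc: "unit_matrix 2 0 0 \<in> carrier_mat 2 2" by (rule unit_matrix_carrier)
  have lin_id: "linear_map 2 id" by (simp add: linear_map_def)
  have tr: "mtrace (F X) = mtrace X" if X: "X \<in> carrier_mat 2 2" for X
  proof -
    \<comment> \<open>Tested on \<open>X \<otimes> E_00\<close>, whose second factor has trace
      one.\<close>
    have "mtrace (tensor_mat (F X) (unit_matrix 2 0 0)) = mtrace (tensor_mat X (unit_matrix 2 0 0))"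
      using tr\<Phi>[OF tensor_mat_carrier[OF X uc]] eq[OF tensor_mat_carrier[OF X uc]]
        tensor_map_tensor_mat[OF lin lin_id X uc] by simp
    then show ?thesis
      unfolding mtrace_tensor_mat[OF X uc] mtrace_tensor_mat[OF linear_map_carrier[OF lin X] uc]
      by (simp add: mtrace_unit_matrix)
  qed
  let ?h = "complex_of_real (sqrt (1 / 2))"
  have hh: "?h * cnj ?h = 1 / 2"
  proof -
    have "?h * cnj ?h = complex_of_real (sqrt (1 / 2) * sqrt (1 / 2))"
      by (simp only: complex_cnj_complex_of_real of_real_mult)
    also have "\<dots> = 1 / 2" by (subst real_sqrt_mult_self) simp
    finally show ?thesis .
  qed
  \<comment> \<open>Equal digits of \<open>r\<close> single out \<open>e_0 \<otimes> e_0\<close> and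
    \<open>e_1 \<otimes> e_1\<close>: the normalised Bell vector.\<close>
  define v where "v r = (if r div 2 = r mod 2 then ?h else 0)" for r :: nat
  define \<Omega> where "\<Omega> = dyad (2 * 2) v"
  have \<Omega>c: "\<Omega> \<in> carrier_mat (2 * 2) (2 * 2)" by (simp add: \<Omega>_def dyad_def)
  have \<Omega>: "\<Omega> $$ (i * 2 + k, j * 2 + l) = (if i = k then if j = l then 1 / 2 else 0 else 0)"
    if "i < 2" "j < 2" "k < 2" "l < 2" for i j k l
    using that hh mult_add_less[of i 2 k 2] mult_add_less[of j 2 l 2]
    by (simp add: \<Omega>_def dyad_def v_def)
  have "state (2 * 2) \<Omega>"
  proof -
    have "mtrace \<Omega> = (\<Sum>r<2 * 2. \<Omega> $$ (r, r))" using \<Omega>c by (simp add: mtrace_def)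
    also have "\<dots> = (\<Sum>i<2 :: nat. \<Sum>k<2 :: nat. if i = k then 1 / 2 else 0)"
      unfolding sum_lessThan_mult by (intro sum.cong refl) (simp add: \<Omega>)
    also have "\<dots> = 1" by (simp add: sum_lessThan_2)
    finally show ?thesis using psd_dyad by (simp add: state_def \<Omega>_def)
  qed
  then have "separable 2 2 (\<Phi> \<Omega>)" using \<Phi> by (simp add: entanglement_annihilating_def)
  then obtain m :: nat and p \<sigma> \<tau> where st: "\<forall>k<m. 0 \<le> p k \<and> state 2 (\<sigma> k) \<and> state 2 (\<tau> k)"
    and sep: "\<Phi> \<Omega> = mat (2 * 2) (2 * 2) (\<lambda>(r, s). \<Sum>k<m. complex_of_real (p k) * tensor_mat (\<sigma> k) (\<tau> k) $$ (r, s))"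
    unfolding separable_def by blast
  have c: "\<sigma> k \<in> carrier_mat 2 2" "\<tau> k \<in> carrier_mat 2 2" if "k < m" for k
    using st that by (auto simp: state_def psd_iff_qform)
  show ?thesis
  proof (rule measure_prepare_entanglement_breaking[OF lin])
    show "\<forall>X\<in>carrier_mat 2 2. mtrace (F X) = mtrace X" using tr by blast
    \<comment> \<open>The factor 2 undoes the entries 1/2 of \<open>\<Omega>\<close>; the Choi
      matrix has trace 2.\<close>
    show "0 \<le> 2 * p k" "state 2 (\<sigma> k)" "psd 2 (\<tau> k)" if "k < m" for k
      using st that by (auto simp: state_def)
    fix i j a b :: nat assume ij: "i < 2" "j < 2" and ab: "a < 2" "b < 2"
    have lt: "a * 2 + i < 2 * 2" "b * 2 + j < 2 * 2" using ij ab by (auto intro: mult_add_less)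
    have "tensor_map 2 2 F id \<Omega> $$ (a * 2 + i, b * 2 + j)
        = (\<Sum>i'<2. \<Sum>j'<2. if i' = i then if j' = j then 1 / 2 * F (unit_matrix 2 i' j') $$ (a, b) else 0 else 0)"
      unfolding tensor_map_id_index[OF lin lt] using ij by (intro sum.cong refl) (simp add: \<Omega>)
    also have "\<dots> = 1 / 2 * F (unit_matrix 2 i j) $$ (a, b)"
      using less_2_cases[OF ij(1)] less_2_cases[OF ij(2)] unfolding sum_lessThan_2 by auto
    finally have half: "tensor_map 2 2 F id \<Omega> $$ (a * 2 + i, b * 2 + j) = 1 / 2 * F (unit_matrix 2 i j) $$ (a, b)" .
    have "F (unit_matrix 2 i j) $$ (a, b) = 2 * \<Phi> \<Omega> $$ (a * 2 + i, b * 2 + j)"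
      unfolding eq[OF \<Omega>c] half by simp
    also have "\<dots> = 2 * (\<Sum>k<m. complex_of_real (p k) * tensor_mat (\<sigma> k) (\<tau> k) $$ (a * 2 + i, b * 2 + j))"
      unfolding sep using lt by simp
    also have "\<dots> = (\<Sum>k<m. complex_of_real (2 * p k) * \<sigma> k $$ (a, b) * \<tau> k $$ (i, j))"
      unfolding sum_distrib_left
      by (intro sum.cong refl) (simp add: tensor_mat_index[OF c ab ij])
    finally show "F (unit_matrix 2 i j) $$ (a, b) = (\<Sum>k<m. complex_of_real (2 * p k) * \<sigma> k $$ (a, b) * \<tau> k $$ (i, j))" .
  qed
qed

text \<open>By linearity it suffices to compare both sides on \<open>E_ij \<otimes> E_kl\<close>,
  where the product formula applies.\<close>

lemma tensor_id_summand_factorizes: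
  assumes F: "linear_map 2 F" and \<Phi>: "channel (2 * 2) \<Phi>" and \<Psi>: "channel (2 * 2) \<Psi>" and t: "0 < t" "t < 1"
    and sum: "\<And>X. X \<in> carrier_mat (2 * 2) (2 * 2) \<Longrightarrow>
      tensor_map 2 2 F id X = complex_of_real t \<cdot>\<^sub>m \<Phi> X + complex_of_real (1 - t) \<cdot>\<^sub>m \<Psi> X"
    and X: "X \<in> carrier_mat (2 * 2) (2 * 2)"
  shows "\<Phi> X = tensor_map 2 2 (coblock \<Phi> 0 0 (unit_matrix 2 0 0)) id X"
proof (rule eq_matI)
  let ?G = "coblock \<Phi> 0 0 (unit_matrix 2 0 0)"
  have lin: "linear_map (2 * 2) \<Phi>" using \<Phi> by (simp add: channel_def)
  have uc: "unit_matrix 2 i j \<in> carrier_mat 2 2" for i j by (rule unit_matrix_carrier)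
  have linG: "linear_map 2 ?G" by (rule linear_map_coblock[OF lin uc]) simp_all
  show "dim_row (\<Phi> X) = dim_row (tensor_map 2 2 ?G id X)" "dim_col (\<Phi> X) = dim_col (tensor_map 2 2 ?G id X)"
    using linear_map_carrier[OF lin X] by (auto simp: tensor_map_def)
  fix r s assume "r < dim_row (tensor_map 2 2 ?G id X)" "s < dim_col (tensor_map 2 2 ?G id X)"
  then have rs: "r < 2 * 2" "s < 2 * 2" by (auto simp: tensor_map_def)
  note q = div_mod_less[OF rs(1)] div_mod_less[OF rs(2)]
  have unit: "\<Phi> (unit_matrix (2 * 2) (i * 2 + k) (j * 2 + l)) $$ (r, s)
      = (if k = r mod 2 \<and> l = s mod 2 then ?G (unit_matrix 2 i j) $$ (r div 2, s div 2) else 0)"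
    if "i < 2" "j < 2" "k < 2" "l < 2" for i j k l
  proof -
    have "\<Phi> (unit_matrix (2 * 2) (i * 2 + k) (j * 2 + l)) $$ (r div 2 * 2 + r mod 2, s div 2 * 2 + s mod 2)
      = (if k = r mod 2 \<and> l = s mod 2
         then \<Phi> (tensor_mat (unit_matrix 2 i j) (unit_matrix 2 0 0)) $$ (r div 2 * 2, s div 2 * 2) else 0)"
      unfolding tensor_mat_unit_matrix[OF that, symmetric]
      by (rule tensor_id_summand_product[OF F \<Phi> \<Psi> t sum uc that(3,4) q(2) q(4) q(1) q(3)])
    then show ?thesis using q by (simp add: coblock_def)
  qed
  have r2: "r mod 2 = 0 \<or> r mod 2 = 1" and s2: "s mod 2 = 0 \<or> s mod 2 = 1" by auto
  have "\<Phi> X $$ (r, s) = (\<Sum>i<2. \<Sum>k<2. \<Sum>j<2. \<Sum>l<2. X $$ (i * 2 + k, j * 2 + l) *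
      (if k = r mod 2 \<and> l = s mod 2 then ?G (unit_matrix 2 i j) $$ (r div 2, s div 2) else 0))"
    unfolding linear_map_index[OF lin X rs] sum_lessThan_mult
    by (intro sum.cong refl) (simp only: unit lessThan_iff)
  also have "\<dots> = tensor_map 2 2 ?G id X $$ (r, s)"
    unfolding tensor_map_id_index[OF linG rs] sum_lessThan_2
    using r2 s2 by (elim disjE) (simp_all del: One_nat_def add_2_eq_Suc add_2_eq_Suc')
  finally show "\<Phi> X $$ (r, s) = tensor_map 2 2 ?G id X $$ (r, s)" .
qed

lemma EA_extremal_tensor_map_id:
  assumes ext: "EB_extremal F"
  shows "EA_extremal (tensor_map 2 2 F id)"
  unfolding EA_extremal_def extremal_def mem_Collect_eq
proof (intro conjI ballI allI impI)
  have EB: "entanglement_breaking F" using ext by (simp add: EB_extremal_def extremal_def)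
  then show "entanglement_annihilating (tensor_map 2 2 F id)" by (rule entanglement_annihilating_tensor_map_id)
  have F: "linear_map 2 F" using EB by (simp add: entanglement_breaking_def channel_def)
  fix \<Phi> \<Psi> and t :: real and X :: "complex mat"
  assume "\<Phi> \<in> {\<Phi>. entanglement_annihilating \<Phi>}" "\<Psi> \<in> {\<Phi>. entanglement_annihilating \<Phi>}"
    and t: "0 < t" "t < 1"
    and comb: "\<forall>X\<in>carrier_mat (2 * 2) (2 * 2).
      tensor_map 2 2 F id X = complex_of_real t \<cdot>\<^sub>m \<Phi> X + complex_of_real (1 - t) \<cdot>\<^sub>m \<Psi> X"
    and X: "X \<in> carrier_mat (2 * 2) (2 * 2)"
  then have EA: "entanglement_annihilating \<Phi>" "entanglement_annihilating \<Psi>" by auto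
  then have ch: "channel (2 * 2) \<Phi>" "channel (2 * 2) \<Psi>" by (auto simp: entanglement_annihilating_def)
  then have lin: "linear_map (2 * 2) \<Phi>" "linear_map (2 * 2) \<Psi>" by (auto simp: channel_def)
  let ?E = "unit_matrix 2 0 0"
  have uc: "unit_matrix 2 i j \<in> carrier_mat 2 2" for i j by (rule unit_matrix_carrier)
  define F1 F2 where "F1 = coblock \<Phi> 0 0 ?E" and "F2 = coblock \<Psi> 0 0 ?E"
  have linF: "linear_map 2 F1" "linear_map 2 F2"
    unfolding F1_def F2_def by (rule linear_map_coblock[OF lin(1) uc], simp_all) (rule linear_map_coblock[OF lin(2) uc], simp_all)
  have f\<Phi>: "\<Phi> X = tensor_map 2 2 F1 id X" if "X \<in> carrier_mat (2 * 2) (2 * 2)" for X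
    unfolding F1_def using tensor_id_summand_factorizes[OF F ch t _ that] comb by blast
  have f\<Psi>: "\<Psi> X = tensor_map 2 2 F2 id X" if "X \<in> carrier_mat (2 * 2) (2 * 2)" for X
    unfolding F2_def
  \<comment> \<open>The situation is symmetric under exchanging \<open>\<Phi>\<close> with
    \<open>\<Psi>\<close> and \<open>t\<close> with \<open>1 - t\<close>.\<close>
  proof (rule tensor_id_summand_factorizes[OF F ch(2,1) _ _ _ that])
    show "0 < 1 - t" "1 - t < 1" using t by auto
    show "tensor_map 2 2 F id Y = complex_of_real (1 - t) \<cdot>\<^sub>m \<Psi> Y + complex_of_real (1 - (1 - t)) \<cdot>\<^sub>m \<Phi> Y"
      if Y: "Y \<in> carrier_mat (2 * 2) (2 * 2)" for Y
    proof -
      have "complex_of_real t \<cdot>\<^sub>m \<Phi> Y + complex_of_real (1 - t) \<cdot>\<^sub>m \<Psi> Y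
          = complex_of_real (1 - t) \<cdot>\<^sub>m \<Psi> Y + complex_of_real t \<cdot>\<^sub>m \<Phi> Y"
        using linear_map_carrier[OF lin(1) Y] linear_map_carrier[OF lin(2) Y]
        by (intro comm_add_mat[of _ "2 * 2" "2 * 2"]) simp_all
      then show ?thesis using comb Y by simp
    qed
  qed
  have EB1: "entanglement_breaking F1" by (rule entanglement_breaking_left_factor[OF EA(1) linF(1) f\<Phi>])
  have EB2: "entanglement_breaking F2" by (rule entanglement_breaking_left_factor[OF EA(2) linF(2) f\<Psi>])
  have "F Y = complex_of_real t \<cdot>\<^sub>m F1 Y + complex_of_real (1 - t) \<cdot>\<^sub>m F2 Y" if Y: "Y \<in> carrier_mat 2 2" for Y
  proof (rule eq_matI)
    note c = linear_map_carrier[OF F Y] linear_map_carrier[OF linF(1) Y] linear_map_carrier[OF linF(2) Y]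
    show "dim_row (F Y) = dim_row (complex_of_real t \<cdot>\<^sub>m F1 Y + complex_of_real (1 - t) \<cdot>\<^sub>m F2 Y)"
      "dim_col (F Y) = dim_col (complex_of_real t \<cdot>\<^sub>m F1 Y + complex_of_real (1 - t) \<cdot>\<^sub>m F2 Y)"
      using c by auto
    fix a b assume "a < dim_row (complex_of_real t \<cdot>\<^sub>m F1 Y + complex_of_real (1 - t) \<cdot>\<^sub>m F2 Y)"
      "b < dim_col (complex_of_real t \<cdot>\<^sub>m F1 Y + complex_of_real (1 - t) \<cdot>\<^sub>m F2 Y)"
    then have ab: "a < 2" "b < 2" using c by auto
    have lt: "a * 2 + 0 < 2 * 2" "b * 2 + 0 < 2 * 2" using mult_add_less[OF ab(1), of 0 2] mult_add_less[OF ab(2), of 0 2] by auto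
    note YE = tensor_mat_carrier[OF Y uc, of 0 0]
    \<comment> \<open>The matrix \<open>F Y\<close> sits in the even rows and columns of
      \<open>F Y \<otimes> E_00\<close>, which turns the decomposition of
      \<open>F \<otimes> I\<close> into one of \<open>F\<close>.\<close>
    have "F Y $$ (a, b) = tensor_mat (F Y) ?E $$ (a * 2 + 0, b * 2 + 0)"
      unfolding tensor_mat_index[OF c(1) uc ab zero_less_numeral zero_less_numeral] by (simp add: unit_matrix_def)
    also have "tensor_mat (F Y) ?E = tensor_map 2 2 F id (tensor_mat Y ?E)"
      using tensor_map_tensor_mat[OF F _ Y uc, where G = id] by (simp add: linear_map_def)
    also have "\<dots> = complex_of_real t \<cdot>\<^sub>m \<Phi> (tensor_mat Y ?E) + complex_of_real (1 - t) \<cdot>\<^sub>m \<Psi> (tensor_mat Y ?E)"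
      using comb YE by blast
    also have "\<dots> $$ (a * 2 + 0, b * 2 + 0) = complex_of_real t * F1 Y $$ (a, b) + complex_of_real (1 - t) * F2 Y $$ (a, b)"
      using lt linear_map_carrier[OF lin(1) YE] linear_map_carrier[OF lin(2) YE] ab
      by (simp add: F1_def F2_def coblock_def)
    finally show "F Y $$ (a, b) = (complex_of_real t \<cdot>\<^sub>m F1 Y + complex_of_real (1 - t) \<cdot>\<^sub>m F2 Y) $$ (a, b)"
      using c ab by simp
  qed
  with ext EB1 EB2 t have eqF: "F1 Y = F2 Y" if "Y \<in> carrier_mat 2 2" for Y
    using that unfolding EB_extremal_def extremal_def by blast
  show "\<Phi> X = \<Psi> X"
    \<comment> \<open>\<open>tensor_map\<close> sees its factors only through their values on matrix
      units.\<close>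
    unfolding f\<Phi>[OF X] f\<Psi>[OF X] by (simp add: tensor_map_def eqF uc)
qed

section \<open>Exchanging the two qubits\<close>

text \<open>Exchanges the two binary digits of an index below 4, that is,
  \<open>e_i \<otimes> e_k\<close> with \<open>e_k \<otimes> e_i\<close>.\<close>

definition flip :: "nat \<Rightarrow> nat" where
  "flip r = (r mod 2) * 2 + r div 2"

text \<open>Conjugation by the swap unitary, written as a permutation of indices to avoid matrix
  products.\<close>

definition swap_qubits :: "complex mat \<Rightarrow> complex mat" where
  "swap_qubits X = mat (2 * 2) (2 * 2) (\<lambda>(r, s). X $$ (flip r, flip s))"

lemma flip_index: "k < 2 \<Longrightarrow> flip (i * 2 + k) = k * 2 + i"
  by (simp add: flip_def)

lemma flip_less: "r < 2 * 2 \<Longrightarrow> flip r < 2 * 2"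
  unfolding flip_def by (rule mult_add_less) auto

lemma flip_flip:
  assumes "r < 2 * 2"
  shows "flip (flip r) = r"
proof -
  have "flip (flip r) = flip (r mod 2 * 2 + r div 2)" by (simp add: flip_def)
  also have "\<dots> = r div 2 * 2 + r mod 2" by (rule flip_index) (use assms in auto)
  finally show ?thesis by simp
qed

lemma sum_flip: "(\<Sum>r<2 * 2. g (flip r)) = (\<Sum>r<2 * 2. g r)"
  by (rule sum.reindex_bij_witness[where i = flip and j = flip]) (auto simp: flip_flip flip_less[simplified] flip_flip[simplified])

lemma swap_qubits_carrier: "swap_qubits X \<in> carrier_mat (2 * 2) (2 * 2)"
  by (simp add: swap_qubits_def)

lemma swap_qubits_index: "r < 2 * 2 \<Longrightarrow> s < 2 * 2 \<Longrightarrow> swap_qubits X $$ (r, s) = X $$ (flip r, flip s)"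
  by (simp add: swap_qubits_def)

lemma swap_qubits_swap_qubits:
  assumes "X \<in> carrier_mat (2 * 2) (2 * 2)"
  shows "swap_qubits (swap_qubits X) = X"
proof (rule eq_matI)
  fix r s assume "r < dim_row X" "s < dim_col X"
  then have "r < 2 * 2" "s < 2 * 2" using assms by auto
  then show "swap_qubits (swap_qubits X) $$ (r, s) = X $$ (r, s)"
    by (simp only: swap_qubits_index flip_less flip_flip)
qed (use assms in \<open>auto simp: swap_qubits_def\<close>)

lemma linear_map_swap_qubits: "linear_map (2 * 2) swap_qubits"
  unfolding swap_qubits_def
proof (rule linear_map_matI)
  fix X Y :: "complex mat" and r s :: nat
  assume "X \<in> carrier_mat (2 * 2) (2 * 2)" "Y \<in> carrier_mat (2 * 2) (2 * 2)" "r < 2 * 2" "s < 2 * 2"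
  then show "(X + Y) $$ (flip r, flip s) = X $$ (flip r, flip s) + Y $$ (flip r, flip s)"
    by (intro add_index_carrier[of _ "2 * 2"] flip_less)
next
  fix c and X :: "complex mat" and r s :: nat
  assume "X \<in> carrier_mat (2 * 2) (2 * 2)" "r < 2 * 2" "s < 2 * 2"
  then show "(c \<cdot>\<^sub>m X) $$ (flip r, flip s) = c * X $$ (flip r, flip s)"
    by (intro smult_index_carrier[of _ "2 * 2"] flip_less)
qed

lemma mtrace_swap_qubits:
  assumes "X \<in> carrier_mat (2 * 2) (2 * 2)"
  shows "mtrace (swap_qubits X) = mtrace X"
proof -
  have "mtrace (swap_qubits X) = (\<Sum>r<2 * 2. X $$ (flip r, flip r))"
    by (simp add: mtrace_def swap_qubits_def)
  also have "\<dots> = (\<Sum>r<2 * 2. X $$ (r, r))" by (rule sum_flip)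
  finally show ?thesis using assms by (simp add: mtrace_def)
qed

text \<open>The form at \<open>f\<close> becomes the form of \<open>X\<close> at \<open>f\<close>
  composed with the involution. It serves both for \<open>flip\<close> and for its extension to an
  ancilla.\<close>

lemma psd_reindex:
  assumes X: "psd d X" and less: "\<And>r. r < d \<Longrightarrow> \<pi> r < d" and inv: "\<And>r. r < d \<Longrightarrow> \<pi> (\<pi> r) = r"
  shows "psd d (mat d d (\<lambda>(r, s). X $$ (\<pi> r, \<pi> s)))"
  unfolding psd_iff_qform
proof safe
  fix f
  have sum: "(\<Sum>r<d. g (\<pi> r)) = (\<Sum>r<d. g r)" for g :: "nat \<Rightarrow> complex"
    by (rule sum.reindex_bij_witness[where i = \<pi> and j = \<pi>]) (auto simp: less inv)
  have "qform d (mat d d (\<lambda>(r, s). X $$ (\<pi> r, \<pi> s))) f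
      = (\<Sum>i<d. \<Sum>j<d. X $$ (\<pi> i, \<pi> j) * f (\<pi> (\<pi> j)) * cnj (f (\<pi> (\<pi> i))))"
    by (simp add: qform_def inv)
  also have "\<dots> = (\<Sum>i<d. \<Sum>j<d. X $$ (i, j) * f (\<pi> j) * cnj (f (\<pi> i)))"
    unfolding sum[of "\<lambda>j. X $$ (\<pi> _, j) * f (\<pi> j) * cnj (f (\<pi> (\<pi> _)))"]
    by (rule sum[of "\<lambda>i. \<Sum>j<d. X $$ (i, j) * f (\<pi> j) * cnj (f (\<pi> i))"])
  also have "\<dots> = qform d X (\<lambda>i. f (\<pi> i))" by (simp add: qform_def)
  finally show "0 \<le> qform d (mat d d (\<lambda>(r, s). X $$ (\<pi> r, \<pi> s))) f"
    using X by (simp add: psd_iff_qform)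
qed simp

lemma state_swap_qubits:
  assumes "state (2 * 2) \<rho>"
  shows "state (2 * 2) (swap_qubits \<rho>)"
proof -
  have "psd (2 * 2) \<rho>" "\<rho> \<in> carrier_mat (2 * 2) (2 * 2)" "mtrace \<rho> = 1"
    using assms by (simp_all add: state_def psd_iff_qform)
  then show ?thesis
    unfolding state_def mtrace_swap_qubits[OF \<open>\<rho> \<in> _\<close>]
    unfolding swap_qubits_def by (intro conjI psd_reindex flip_less flip_flip)
qed

lemma separable_swap_qubits:
  assumes "separable 2 2 \<rho>"
  shows "separable 2 2 (swap_qubits \<rho>)"
proof -
  obtain m :: nat and p \<sigma> \<tau> where st: "\<forall>k<m. 0 \<le> p k \<and> state 2 (\<sigma> k) \<and> state 2 (\<tau> k)"
    and p: "(\<Sum>k<m. p k) = 1"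
    and sep: "\<rho> = mat (2 * 2) (2 * 2) (\<lambda>(r, s). \<Sum>k<m. complex_of_real (p k) * tensor_mat (\<sigma> k) (\<tau> k) $$ (r, s))"
    using assms unfolding separable_def by blast
  have c: "\<sigma> k \<in> carrier_mat 2 2" "\<tau> k \<in> carrier_mat 2 2" if "k < m" for k
    using st that by (auto simp: state_def psd_iff_qform)
  have nn: "\<forall>k<m. 0 \<le> p k \<and> state 2 (\<tau> k) \<and> state 2 (\<sigma> k)" using st by blast
  have eq: "swap_qubits \<rho> = mat (2 * 2) (2 * 2) (\<lambda>(r, s). \<Sum>k<m. complex_of_real (p k) * tensor_mat (\<tau> k) (\<sigma> k) $$ (r, s))"
  proof (rule eq_matI, goal_cases)
    case (1 r s)
    then have rs: "r < 2 * 2" "s < 2 * 2" by auto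
    note q = div_mod_less[OF rs(1)] div_mod_less[OF rs(2)]
    have "tensor_mat (\<sigma> k) (\<tau> k) $$ (flip r, flip s) = tensor_mat (\<tau> k) (\<sigma> k) $$ (r, s)" if "k < m" for k
      unfolding flip_def tensor_mat_index[OF c[OF that] q(2) q(4) q(1) q(3)]
      using tensor_mat_index[OF c(2,1)[OF that] q(1) q(3) q(2) q(4)] by (simp add: mult.commute)
    then have "(\<Sum>k<m. complex_of_real (p k) * tensor_mat (\<sigma> k) (\<tau> k) $$ (flip r, flip s))
        = (\<Sum>k<m. complex_of_real (p k) * tensor_mat (\<tau> k) (\<sigma> k) $$ (r, s))" by simp
    then show ?case using rs flip_less[OF rs(1)] flip_less[OF rs(2)] by (simp add: swap_qubits_def sep)
  qed (auto simp: swap_qubits_def)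
  show ?thesis
    unfolding separable_def
    by (rule exI[of _ m], rule exI[of _ p], rule exI[of _ \<tau>], rule exI[of _ \<sigma>], intro conjI nn p eq)
qed

lemma swap_qubits_unit_matrix:
  assumes "i < 2 * 2" "j < 2 * 2"
  shows "swap_qubits (unit_matrix (2 * 2) i j) = unit_matrix (2 * 2) (flip i) (flip j)"
proof (rule eq_matI, goal_cases)
  case (1 r s)
  then have rs: "r < 2 * 2" "s < 2 * 2" by (auto simp: unit_matrix_def)
  have "flip x = y \<longleftrightarrow> x = flip y" if "x < 2 * 2" "y < 2 * 2" for x y
    using flip_flip[OF that(1)] flip_flip[OF that(2)] by auto
  then show ?case
    using assms rs flip_less[OF rs(1)] flip_less[OF rs(2)]
    by (simp only: swap_qubits_index) (simp add: unit_matrix_def)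
qed (auto simp: swap_qubits_def unit_matrix_def)

definition conj_swap :: "(complex mat \<Rightarrow> complex mat) \<Rightarrow> complex mat \<Rightarrow> complex mat" where
  "conj_swap \<Phi> X = swap_qubits (\<Phi> (swap_qubits X))"

lemma linear_map_conj_swap:
  assumes "linear_map (2 * 2) \<Phi>"
  shows "linear_map (2 * 2) (conj_swap \<Phi>)"
  using assms linear_map_swap_qubits by (simp only: linear_map_def conj_swap_def) simp

text \<open>States, traces and separability are invariant under the exchange. For complete
  positivity the exchange has to be carried past the ancilla.\<close>

lemma entanglement_annihilating_conj_swap:
  assumes EA: "entanglement_annihilating \<Phi>"
  shows "entanglement_annihilating (conj_swap \<Phi>)"
proof -
  have lin: "linear_map (2 * 2) \<Phi>" and cp: "completely_positive (2 * 2) \<Phi>"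
    and tr: "\<And>X. X \<in> carrier_mat (2 * 2) (2 * 2) \<Longrightarrow> mtrace (\<Phi> X) = mtrace X"
    and sep: "\<And>\<rho>. state (2 * 2) \<rho> \<Longrightarrow> separable 2 2 (\<Phi> \<rho>)"
    using EA by (simp_all only: entanglement_annihilating_def channel_def)
  note lin' = linear_map_conj_swap[OF lin]
  have "completely_positive (2 * 2) (conj_swap \<Phi>)"
    unfolding completely_positive_def
  proof (intro allI impI)
    fix n X assume X: "psd (2 * 2 * n) X"
    \<comment> \<open>The exchange of the qubits with the ancilla index left alone; \<open>R\<close>
      is the conjugation by it.\<close>
    define \<pi> where "\<pi> r = flip (r div n) * n + r mod n" for r
    have \<pi>: "\<pi> r < 2 * 2 * n" "\<pi> r div n = flip (r div n)" "\<pi> r mod n = r mod n" "\<pi> (\<pi> r) = r"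
      if "r < 2 * 2 * n" for r
    proof -
      note q = div_mod_less[OF that]
      show "\<pi> r < 2 * 2 * n" unfolding \<pi>_def by (rule mult_add_less[OF flip_less[OF q(1)] q(2)])
      show d: "\<pi> r div n = flip (r div n)" and m: "\<pi> r mod n = r mod n"
        using q(2) by (auto simp: \<pi>_def)
      show "\<pi> (\<pi> r) = r" using d m flip_flip[OF q(1)] by (simp add: \<pi>_def[of "\<pi> r"])
    qed
    define R where "R Y = mat (2 * 2 * n) (2 * 2 * n) (\<lambda>(r, s). Y $$ (\<pi> r, \<pi> s))" for Y :: "complex mat"
    have R: "psd (2 * 2 * n) (R Y)" if "psd (2 * 2 * n) Y" for Y
      unfolding R_def by (rule psd_reindex[OF that]) (fact \<pi>)+
    have "tensor_map (2 * 2) n (conj_swap \<Phi>) id X = R (tensor_map (2 * 2) n \<Phi> id (R X))"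
    proof (rule eq_matI, goal_cases)
      case (1 r s)
      then have rs: "r < 2 * 2 * n" "s < 2 * 2 * n" by (simp_all add: R_def)
      note q = div_mod_less[OF rs(1)] div_mod_less[OF rs(2)]
      let ?t = "\<lambda>i j. X $$ (flip i * n + r mod n, flip j * n + s mod n)
          * \<Phi> (unit_matrix (2 * 2) i j) $$ (flip (r div n), flip (s div n))"
      \<comment> \<open>The exchange permutes the matrix units, so the sums over them are merely
        reindexed.\<close>
      have "tensor_map (2 * 2) n (conj_swap \<Phi>) id X $$ (r, s) = (\<Sum>i<2 * 2. \<Sum>j<2 * 2. ?t (flip i) (flip j))"
        unfolding tensor_map_id_index[OF lin' rs] conj_swap_def
        by (intro sum.cong refl)
          (simp only: lessThan_iff swap_qubits_unit_matrix swap_qubits_index q flip_flip)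
      also have "\<dots> = (\<Sum>i<2 * 2. \<Sum>j<2 * 2. ?t i j)"
        unfolding sum_flip[of "\<lambda>j. ?t _ j"] by (rule sum_flip[of "\<lambda>i. \<Sum>j<2 * 2. ?t i j"])
      also have "\<dots> = (\<Sum>i<2 * 2. \<Sum>j<2 * 2. R X $$ (i * n + \<pi> r mod n, j * n + \<pi> s mod n)
          * \<Phi> (unit_matrix (2 * 2) i j) $$ (\<pi> r div n, \<pi> s div n))"
      proof (intro sum.cong refl)
        fix i j :: nat assume "i \<in> {..<2 * 2}" "j \<in> {..<2 * 2}"
        then have "i * n + r mod n < 2 * 2 * n" "j * n + s mod n < 2 * 2 * n"
          using q by (auto intro!: mult_add_less simp del: mult_numeral_left_semiring_numeral)
        then show "?t i j = R X $$ (i * n + \<pi> r mod n, j * n + \<pi> s mod n)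
          * \<Phi> (unit_matrix (2 * 2) i j) $$ (\<pi> r div n, \<pi> s div n)"
          using q \<pi>[OF rs(1)] \<pi>[OF rs(2)] by (simp add: R_def \<pi>_def)
      qed
      also have "\<dots> = tensor_map (2 * 2) n \<Phi> id (R X) $$ (\<pi> r, \<pi> s)"
        by (rule tensor_map_id_index[OF lin \<pi>(1)[OF rs(1)] \<pi>(1)[OF rs(2)], symmetric])
      also have "\<dots> = R (tensor_map (2 * 2) n \<Phi> id (R X)) $$ (r, s)" using rs by (simp add: R_def)
      finally show ?case .
    qed (simp_all add: R_def tensor_map_def)
    then show "psd (2 * 2 * n) (tensor_map (2 * 2) n (conj_swap \<Phi>) id X)"
      using cp R X unfolding completely_positive_def by metis
  qed
  moreover have "mtrace (conj_swap \<Phi> X) = mtrace X" if X: "X \<in> carrier_mat (2 * 2) (2 * 2)" for X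
    unfolding conj_swap_def mtrace_swap_qubits[OF linear_map_carrier[OF lin swap_qubits_carrier]]
      tr[OF swap_qubits_carrier] by (rule mtrace_swap_qubits[OF X])
  moreover have "separable 2 2 (conj_swap \<Phi> \<rho>)" if "state (2 * 2) \<rho>" for \<rho>
    unfolding conj_swap_def by (intro separable_swap_qubits sep state_swap_qubits that)
  ultimately show ?thesis using lin' by (simp only: entanglement_annihilating_def channel_def) blast
qed

text \<open>Conjugation by the exchange is an affine involution of the set of
  entanglement-annihilating maps, so it preserves extreme points: a decomposition of
  \<open>conj_swap \<Phi>\<close> is carried back to one of \<open>\<Phi>\<close>.\<close>

lemma EA_extremal_conj_swap:
  assumes ext: "EA_extremal \<Phi>"
  shows "EA_extremal (conj_swap \<Phi>)"
  unfolding EA_extremal_def extremal_def mem_Collect_eq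
proof (intro conjI ballI allI impI)
  have EA: "entanglement_annihilating \<Phi>" using ext by (simp add: EA_extremal_def extremal_def)
  then show "entanglement_annihilating (conj_swap \<Phi>)" by (rule entanglement_annihilating_conj_swap)
  have lin: "linear_map (2 * 2) \<Psi>" if "entanglement_annihilating \<Psi>" for \<Psi>
    using that by (simp only: entanglement_annihilating_def channel_def)
  fix \<Psi>1 \<Psi>2 and t :: real and X :: "complex mat"
  assume "\<Psi>1 \<in> {\<Phi>. entanglement_annihilating \<Phi>}" "\<Psi>2 \<in> {\<Phi>. entanglement_annihilating \<Phi>}"
    and t: "0 < t" "t < 1"
    and comb: "\<forall>X\<in>carrier_mat (2 * 2) (2 * 2).
      conj_swap \<Phi> X = complex_of_real t \<cdot>\<^sub>m \<Psi>1 X + complex_of_real (1 - t) \<cdot>\<^sub>m \<Psi>2 X"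
    and X: "X \<in> carrier_mat (2 * 2) (2 * 2)"
  then have \<Psi>: "entanglement_annihilating \<Psi>1" "entanglement_annihilating \<Psi>2" by auto
  note c = linear_map_carrier[OF lin[OF \<Psi>(1)] swap_qubits_carrier] linear_map_carrier[OF lin[OF \<Psi>(2)] swap_qubits_carrier]
  have comb': "\<Phi> Y = complex_of_real t \<cdot>\<^sub>m conj_swap \<Psi>1 Y + complex_of_real (1 - t) \<cdot>\<^sub>m conj_swap \<Psi>2 Y"
    if Y: "Y \<in> carrier_mat (2 * 2) (2 * 2)" for Y
  proof -
    have "\<Phi> Y = swap_qubits (conj_swap \<Phi> (swap_qubits Y))"
      unfolding conj_swap_def swap_qubits_swap_qubits[OF Y]
      by (rule swap_qubits_swap_qubits[OF linear_map_carrier[OF lin[OF EA] Y], symmetric])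
    also have "\<dots> = swap_qubits (complex_of_real t \<cdot>\<^sub>m \<Psi>1 (swap_qubits Y) + complex_of_real (1 - t) \<cdot>\<^sub>m \<Psi>2 (swap_qubits Y))"
      using comb swap_qubits_carrier by metis
    also have "\<dots> = complex_of_real t \<cdot>\<^sub>m conj_swap \<Psi>1 Y + complex_of_real (1 - t) \<cdot>\<^sub>m conj_swap \<Psi>2 Y"
      unfolding conj_swap_def
      by (simp only: linear_map_add[OF linear_map_swap_qubits smult_carrier_mat[OF c(1)] smult_carrier_mat[OF c(2)]]
          linear_map_smult[OF linear_map_swap_qubits c(1)] linear_map_smult[OF linear_map_swap_qubits c(2)])
    finally show ?thesis .
  qed
  have eq: "conj_swap \<Psi>1 Y = conj_swap \<Psi>2 Y" if "Y \<in> carrier_mat (2 * 2) (2 * 2)" for Y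
  proof -
    have "\<forall>\<Phi>1\<in>{\<Phi>. entanglement_annihilating \<Phi>}. \<forall>\<Phi>2\<in>{\<Phi>. entanglement_annihilating \<Phi>}. \<forall>t::real. 0 < t \<longrightarrow> t < 1 \<longrightarrow>
        (\<forall>X\<in>carrier_mat (2 * 2) (2 * 2). \<Phi> X = complex_of_real t \<cdot>\<^sub>m \<Phi>1 X + complex_of_real (1 - t) \<cdot>\<^sub>m \<Phi>2 X) \<longrightarrow>
        (\<forall>X\<in>carrier_mat (2 * 2) (2 * 2). \<Phi>1 X = \<Phi>2 X)"
      using ext[unfolded EA_extremal_def extremal_def] by (rule conjunct2)
    from this[THEN bspec, THEN bspec, of "conj_swap \<Psi>1" "conj_swap \<Psi>2"] show ?thesis
      using entanglement_annihilating_conj_swap[OF \<Psi>(1)] entanglement_annihilating_conj_swap[OF \<Psi>(2)] t comb' that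
      by blast
  qed
  have "\<Psi> X = swap_qubits (conj_swap \<Psi> (swap_qubits X))" if "entanglement_annihilating \<Psi>" for \<Psi>
    unfolding conj_swap_def swap_qubits_swap_qubits[OF X]
    by (rule swap_qubits_swap_qubits[OF linear_map_carrier[OF lin[OF that] X], symmetric])
  then show "\<Psi>1 X = \<Psi>2 X" using eq[OF swap_qubits_carrier] \<Psi> by metis
qed

text \<open>An equation between functions on all matrices, since both sides read only entries with
  indices below 4; extremality can thus be transferred by rewriting.\<close>

lemma tensor_map_id_left:
  assumes F: "linear_map 2 F"
  shows "tensor_map 2 2 id F = conj_swap (tensor_map 2 2 F id)"
proof (rule ext, rule eq_matI, goal_cases)
  case (1 X r s)
  then have rs: "r < 2 * 2" "s < 2 * 2" by (auto simp: conj_swap_def swap_qubits_def)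
  note q = div_mod_less[OF rs(1)] div_mod_less[OF rs(2)]
  have uc: "unit_matrix 2 i j \<in> carrier_mat 2 2" for i j by (rule unit_matrix_carrier)
  have T: "tensor_mat (unit_matrix 2 i j) (F (unit_matrix 2 k l)) $$ (r, s)
      = (if r div 2 = i \<and> s div 2 = j then F (unit_matrix 2 k l) $$ (r mod 2, s mod 2) else 0)" for i j k l
    using tensor_mat_index[OF uc linear_map_carrier[OF F uc] q(1) q(3) q(2) q(4), of i j k l] q
    by (auto simp: unit_matrix_def)
  have r2: "r div 2 = 0 \<or> r div 2 = 1" and s2: "s div 2 = 0 \<or> s div 2 = 1" using q by auto
  have "tensor_map 2 2 id F X $$ (r, s) = (\<Sum>i<2. \<Sum>j<2. \<Sum>k<2. \<Sum>l<2. X $$ (i * 2 + k, j * 2 + l) *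
      (if r div 2 = i \<and> s div 2 = j then F (unit_matrix 2 k l) $$ (r mod 2, s mod 2) else 0))"
    using rs by (simp add: tensor_map_def T)
  also have "\<dots> = (\<Sum>k<2. \<Sum>l<2. X $$ (r div 2 * 2 + k, s div 2 * 2 + l) * F (unit_matrix 2 k l) $$ (r mod 2, s mod 2))"
    unfolding sum_lessThan_2 using r2 s2 by (elim disjE) simp_all
  also have "\<dots> = (\<Sum>k<2. \<Sum>l<2. swap_qubits X $$ (k * 2 + flip r mod 2, l * 2 + flip s mod 2)
      * F (unit_matrix 2 k l) $$ (flip r div 2, flip s div 2))"
  proof (intro sum.cong refl)
    fix k l :: nat assume "k \<in> {..<2}" "l \<in> {..<2}"
    then have kl: "k * 2 + r div 2 < 2 * 2" "l * 2 + s div 2 < 2 * 2" using q by auto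
    have f: "flip r mod 2 = r div 2" "flip r div 2 = r mod 2" "flip s mod 2 = s div 2" "flip s div 2 = s mod 2"
      using q by (auto simp: flip_def)
    show "X $$ (r div 2 * 2 + k, s div 2 * 2 + l) * F (unit_matrix 2 k l) $$ (r mod 2, s mod 2)
      = swap_qubits X $$ (k * 2 + flip r mod 2, l * 2 + flip s mod 2)
        * F (unit_matrix 2 k l) $$ (flip r div 2, flip s div 2)"
      unfolding f swap_qubits_index[OF kl] flip_index[OF q(1)] flip_index[OF q(3)] ..
  qed
  also have "\<dots> = conj_swap (tensor_map 2 2 F id) X $$ (r, s)"
    unfolding conj_swap_def swap_qubits_index[OF rs]
    by (rule tensor_map_id_index[OF F flip_less[OF rs(1)] flip_less[OF rs(2)], symmetric])
  finally show ?case .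
qed (simp_all add: conj_swap_def swap_qubits_def tensor_map_def)

theorem proposition6:
  fixes F :: "complex mat \<Rightarrow> complex mat"
  assumes "EB_extremal F"
  shows "EA_extremal (tensor_map 2 2 F id) \<and> EA_extremal (tensor_map 2 2 id F)"
proof
  show "EA_extremal (tensor_map 2 2 F id)" by (rule EA_extremal_tensor_map_id[OF assms])
  moreover have "linear_map 2 F"
    using assms by (simp add: EB_extremal_def extremal_def entanglement_breaking_def channel_def)
  ultimately show "EA_extremal (tensor_map 2 2 id F)"
    by (simp only: tensor_map_id_left EA_extremal_conj_swap)
qed

end
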